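(* Let $y=(y_0,\dots,y_n)$ satisfy the model with $m^\star$ change-points $$y_i=\mu_k^\star+\eta_i,\qquad t_{n,k}^\star+1\le i\le t_{n,k+1}^\star,\ 0\le k\le m^\star,\qquad y_0=\mu_0^\star+\eta_0,$$ where $(\eta_i)_{i\in\mathbb Z}$ is the zero-mean stationary AR(1) solution of $\eta_i=\rho^\star\eta_{i-1}+\epsilon_i$, with the assumptions given in the context. Let $(\overline\rho_n)$ be a sequence of real-valued random variables with $\overline\rho_n-\rho^\star=O_P(n^{-1/2})$. Let $(\Delta_n)$ be a real sequence with $n^{-1}\Delta_n\to0$ and $n^{-\alpha}\Delta_n\to+\infty$ for some $\alpha>0$. Let $m_{\max}\ge m^\star$ be a fixed integer and $(\beta_n)_{n\ge1}$ a sequence of positive real numbers such that, as $n\to\infty$, $$\beta_n\to0,\qquad n^{1/2}\beta_n\to+\infty,\qquad \Delta_n\beta_n\to+\infty.$$ Define $$\widehat m=\operatorname*{arg\,min}_{0\le m\le m_{\max}}\Big\{\frac1n SS_m(y,\overline\rho_n)+\beta_n m\Big\}.$$ Then $\widehat m$ converges in probability to $m^\star$. This holds when the $\epsilon_i$ are i.i.d. zero-mean Gaussian, and still holds if the $\epsilon_i$ are only assumed to be independent, centered and with finite second-order moment (common variance $\sigma^{\star2}$).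
   Context: Parameters. $m^\star\ge0$ is the true number of change-points; $0=\tau_0^\star<\tau_1^\star<\dots<\tau_{m^\star+1}^\star=1$, $t_{n,k}^\star=\lfloor n\tau_k^\star\rfloor$; $\mu_0^\star,\dots,\mu_{m^\star}^\star\in\mathbb{R}$ with $\mu_k^\star\ne\mu_{k-1}^\star$ for $1\le k\le m^\star$; $|\rho^\star|<1$; $\sigma^\star>0$. These do not depend on $n$. Noise. $(\epsilon_i)_{i\in\mathbb Z}$ are zero-mean with variance $\sigma^{\star2}$; $\eta_i=\sum_{j\ge0}(\rho^\star)^j\epsilon_{i-j}$ ("stationary" is understood in the second-order sense when the $\epsilon_i$ are not identically distributed). Admissible segmentations: for each $m$, $\mathcal{A}_{n,m}=\{(t_0,\dots,t_{m+1}) \text{ integers}: t_0=0<t_1<\dots<t_{m+1}=n,\ t_k-t_{k-1}\ge\Delta_n\ \forall k=1,\dots,m+1\}$. Criterion: for $x=(x_0,\dots,x_n)$ and $\rho\in\mathbb{R}$, $$SS_m(x,\rho)=\min_{\boldsymbol\delta\in\mathbb{R}^{m+1},\,\boldsymbol t\in\mathcal A_{n,m}}\ \sum_{k=0}^m\sum_{i=t_k+1}^{t_{k+1}}(x_i-\rho x_{i-1}-\delta_k)^2,$$ defined for $n$ large enough that $\mathcal A_{n,m}\neq\emptyset$ for all $m\le m_{\max}$. *)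

theory Defs
  imports "HOL-Probability.Probability"
begin

text \<open>A segmentation is a function \<open>t\<close> on the naturals of which only the values
  \<open>t 0, \<dots>, t (m + 1)\<close> matter; likewise only \<open>\<delta> 0, \<dots>, \<delta> m\<close> matter in \<open>residual_ss\<close>.\<close>

definition admissible :: "real \<Rightarrow> nat \<Rightarrow> nat \<Rightarrow> (nat \<Rightarrow> nat) set" where
  "admissible D n m = {t. t 0 = 0 \<and> t (m + 1) = n \<and>
     (\<forall>k\<in>{1..m + 1}. t (k - 1) < t k \<and> real (t k) - real (t (k - 1)) \<ge> D)}"

definition residual_ss ::
  "nat \<Rightarrow> (nat \<Rightarrow> real) \<Rightarrow> real \<Rightarrow> (nat \<Rightarrow> real) \<Rightarrow> (nat \<Rightarrow> nat) \<Rightarrow> real" where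
  "residual_ss m x \<rho> \<delta> t =
     (\<Sum>k=0..m. \<Sum>i=t k + 1..t (k + 1). (x i - \<rho> * x (i - 1) - \<delta> k)\<^sup>2)"

text \<open>The infimum is attained whenever an admissible segmentation exists,
  see \<open>SS_attained\<close> below.\<close>

definition SS :: "real \<Rightarrow> nat \<Rightarrow> nat \<Rightarrow> (nat \<Rightarrow> real) \<Rightarrow> real \<Rightarrow> real" where
  "SS D n m x \<rho> = Inf {residual_ss m x \<rho> \<delta> t |\<delta> t. t \<in> admissible D n m}"

definition bounded_in_prob :: "'a measure \<Rightarrow> (nat \<Rightarrow> 'a \<Rightarrow> real) \<Rightarrow> (nat \<Rightarrow> real) \<Rightarrow> bool" where
  "bounded_in_prob M X a \<longleftrightarrow> (\<forall>e>0. \<exists>C.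
     \<forall>\<^sub>F n in sequentially. measure M {\<omega> \<in> space M. \<bar>X n \<omega>\<bar> > C * a n} < e)"

definition converges_in_prob :: "'a measure \<Rightarrow> (nat \<Rightarrow> 'a \<Rightarrow> real) \<Rightarrow> real \<Rightarrow> bool" where
  "converges_in_prob M X c \<longleftrightarrow> (\<forall>e>0.
     (\<lambda>n. measure M {\<omega> \<in> space M. \<bar>X n \<omega> - c\<bar> > e}) \<longlonglongrightarrow> 0)"

definition gaussian_noise :: "'a measure \<Rightarrow> real \<Rightarrow> (int \<Rightarrow> 'a \<Rightarrow> real) \<Rightarrow> bool" where
  "gaussian_noise M \<sigma> \<epsilon> \<longleftrightarrow> prob_space.indep_vars M (\<lambda>_. borel) \<epsilon> UNIV \<and>
     (\<forall>i. distributed M lborel (\<epsilon> i) (normal_density 0 \<sigma>))"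

definition indep_noise :: "'a measure \<Rightarrow> real \<Rightarrow> (int \<Rightarrow> 'a \<Rightarrow> real) \<Rightarrow> bool" where
  "indep_noise M \<sigma> \<epsilon> \<longleftrightarrow> prob_space.indep_vars M (\<lambda>_. borel) \<epsilon> UNIV \<and>
     (\<forall>i. integrable M (\<lambda>\<omega>. (\<epsilon> i \<omega>)\<^sup>2) \<and>
          prob_space.expectation M (\<epsilon> i) = 0 \<and>
          prob_space.variance M (\<epsilon> i) = \<sigma>\<^sup>2)"

text \<open>The series converges absolutely almost surely when \<open>\<bar>\<rho>\<bar> < 1\<close> and the \<open>\<epsilon> i\<close> have
  bounded second moments, so this determines each \<open>\<eta> i\<close> up to a null set.\<close>

definition stationary_ar1 ::
  "'a measure \<Rightarrow> real \<Rightarrow> (int \<Rightarrow> 'a \<Rightarrow> real) \<Rightarrow> (int \<Rightarrow> 'a \<Rightarrow> real) \<Rightarrow> bool" where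
  "stationary_ar1 M \<rho> \<epsilon> \<eta> \<longleftrightarrow> (\<forall>i. \<eta> i \<in> borel_measurable M \<and>
     (AE \<omega> in M. (\<lambda>j. \<rho> ^ j * \<epsilon> (i - int j) \<omega>) sums \<eta> i \<omega>))"

definition cp_time :: "(nat \<Rightarrow> real) \<Rightarrow> nat \<Rightarrow> nat \<Rightarrow> nat" where
  "cp_time \<tau> n k = nat \<lfloor>real n * \<tau> k\<rfloor>"

definition change_point_model ::
  "'a measure \<Rightarrow> nat \<Rightarrow> (nat \<Rightarrow> real) \<Rightarrow> (nat \<Rightarrow> real) \<Rightarrow> (int \<Rightarrow> 'a \<Rightarrow> real) \<Rightarrow> nat
    \<Rightarrow> (nat \<Rightarrow> 'a \<Rightarrow> real) \<Rightarrow> bool" where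
  "change_point_model M m \<tau> \<mu> \<eta> n y \<longleftrightarrow> (\<forall>\<omega>\<in>space M.
     y 0 \<omega> = \<mu> 0 + \<eta> 0 \<omega> \<and>
     (\<forall>k\<in>{0..m}. \<forall>i\<in>{cp_time \<tau> n k + 1..cp_time \<tau> n (k + 1)}.
        y i \<omega> = \<mu> k + \<eta> (int i) \<omega>))"

lemma sum_sq_mean_le:
  fixes f :: "'b \<Rightarrow> real"
  assumes "finite I"
  shows "(\<Sum>i\<in>I. (f i - (\<Sum>j\<in>I. f j) / real (card I))\<^sup>2) \<le> (\<Sum>i\<in>I. (f i - d)\<^sup>2)"
proof (cases "I = {}")
  case False
  define c where "c = (\<Sum>j\<in>I. f j) / real (card I)"
  have "(\<Sum>i\<in>I. f i - c) = 0"
    using False assms by (simp add: c_def sum_subtractf)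
  then have z: "(\<Sum>i\<in>I. 2 * (c - d) * (f i - c)) = 0"
    by (simp flip: sum_distrib_left)
  have "(\<Sum>i\<in>I. (f i - d)\<^sup>2) = (\<Sum>i\<in>I. (f i - c)\<^sup>2 + 2 * (c - d) * (f i - c) + (c - d)\<^sup>2)"
    by (intro sum.cong refl) (simp add: power2_eq_square algebra_simps)
  also have "\<dots> = (\<Sum>i\<in>I. (f i - c)\<^sup>2) + (\<Sum>i\<in>I. (c - d)\<^sup>2)"
    using z by (simp add: sum.distrib)
  finally have "(\<Sum>i\<in>I. (f i - c)\<^sup>2) \<le> (\<Sum>i\<in>I. (f i - d)\<^sup>2)"
    by (simp add: sum_nonneg)
  then show ?thesis by (simp add: c_def)
qed simp

lemma admissible_le:
  assumes t: "t \<in> admissible D n m" and k: "k \<le> m + 1"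
  shows "t k \<le> n"
proof -
  have "t k \<le> t (m + 1)" using k
  proof (induction k rule: inc_induct)
    case (step l)
    then have "Suc l \<in> {1..m + 1}" by auto
    with t have "t (Suc l - 1) < t (Suc l)" unfolding admissible_def by blast
    with step show ?case by simp
  qed simp
  with t show ?thesis by (simp add: admissible_def)
qed

lemma SS_attained:
  assumes "admissible D n m \<noteq> {}"
  shows "\<exists>\<delta>. \<exists>t\<in>admissible D n m. SS D n m x \<rho> = residual_ss m x \<rho> \<delta> t \<and>
           (\<forall>\<delta>'. \<forall>t'\<in>admissible D n m. residual_ss m x \<rho> \<delta> t \<le> residual_ss m x \<rho> \<delta>' t')"
proof -
  let ?A = "admissible D n m"
  define z where "z i = x i - \<rho> * x (i - 1)" for i
  define d where "d t k = (\<Sum>i=t k + 1..t (k + 1). z i) / real (card {t k + 1..t (k + 1)})"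
    for t :: "nat \<Rightarrow> nat" and k :: nat
  define g where "g t = residual_ss m x \<rho> (d t) t" for t
  have opt: "g t \<le> residual_ss m x \<rho> \<delta> t" for \<delta> t
    unfolding g_def residual_ss_def d_def z_def[symmetric]
    by (intro sum_mono sum_sq_mean_le) simp
  have cong: "g (restrict t {..m + 1}) = g t" for t
    unfolding g_def residual_ss_def by (intro sum.cong refl) (auto simp: d_def)
  have "finite ((\<lambda>t. restrict t {..m + 1}) ` ?A)"
    by (rule finite_subset[of _ "{..m + 1} \<rightarrow>\<^sub>E {..n}"])
       (auto intro!: finite_PiE dest: admissible_le split: if_splits)
  then have "finite (g ` (\<lambda>t. restrict t {..m + 1}) ` ?A)" by simp
  then have fin: "finite (g ` ?A)" by (simp only: image_image cong)
  have "Min (g ` ?A) \<in> g ` ?A" using fin assms by (intro Min_in) auto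
  then obtain t where t: "t \<in> ?A" "g t = Min (g ` ?A)" by auto
  have le: "g t \<le> residual_ss m x \<rho> \<delta>' t'" if "t' \<in> ?A" for \<delta>' t'
    using order_trans[OF _ opt[of t' \<delta>']] Min_le[OF fin, of "g t'"] that t(2) by auto
  have "SS D n m x \<rho> = g t"
    unfolding SS_def
  proof (rule cInf_eq_minimum)
    show "g t \<in> {residual_ss m x \<rho> \<delta> t |\<delta> t. t \<in> ?A}"
      using t(1) unfolding g_def by blast
  qed (use le in blast)
  with t le show ?thesis unfolding g_def by blast
qed

end

theory Submission
  imports Defs "HOL-Real_Asymp.Real_Asymp"
begin

text \<open>Write \<open>x\<^sub>i = y\<^sub>i - r y\<^sub>i\<^sub>-\<^sub>1\<close>, where \<open>r\<close> is the estimated autoregression coefficient. Up to an error of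
bounded square norm this is a piecewise constant signal with the true change-points plus the
independent innovations (\<open>quasi_differenced_model\<close>): the estimation error contributes
\<open>(\<rho> - r)\<^sup>2 \<Sum> \<eta>\<^sub>i\<^sup>2 = O(1 / n) O(n)\<close>, and each change-point spoils one observation.

The true segmentation with the true levels leaves the sum of the squared errors \<open>e\<close> as residual. Any
other segmentation is compared with it on the common refinement of the two. A piece of length \<open>l\<close>
with a level that is wrong by \<open>c\<close> costs at least \<open>l c\<^sup>2 / 2\<close>, minus twice the gain \<open>(\<Sum> e)\<^sup>2 / l\<close> that
fitting a mean to the noise can bring (\<open>residual_ss_ge\<close>). Two facts then suffice.

A segmentation with too few change-points leaves a window of length proportional to \<open>n\<close> around some
true change-point without a breakpoint, by the pigeonhole principle, and so pays a cost of order \<open>n\<close>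
(\<open>missed_change_point_cost\<close>). This beats all the penalties, since \<open>\<beta>\<^sub>n\<close> tends to 0.

A segmentation with too many change-points saves at most the gains of the noise, which are
\<open>o(n \<beta>\<^sub>n)\<close> uniformly over all segmentations. The reason is that a piece of the refinement either is a
whole segment, so that it has length at least \<open>\<Delta>\<^sub>n\<close>, or ends at one of the finitely many true
change-points. All intervals of length at least \<open>D\<close> are handled at once by the sum over the \<open>n / D\<close>
blocks of length \<open>D\<close> of the squared maxima of the partial sums in the block, divided by \<open>D\<close>
(\<open>gain_le_block_max\<close>). By Doob's inequality (\<open>run_max_L2\<close>) this sum has an expectation of order
\<open>n / D\<close>, and second moments are enough. For \<open>D = \<Delta>\<^sub>n\<close> this is \<open>o(n \<beta>\<^sub>n)\<close> exactly because \<open>\<Delta>\<^sub>n \<beta>\<^sub>n\<close>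
diverges. A piece that ends at a true change-point is treated with \<open>D = \<surd>n\<close> if it is longer than
that, and otherwise its gain is at most the sum of the squared innovations in a window of length of
order \<open>\<surd>n\<close>; both are of order \<open>\<surd>n\<close>, hence \<open>o(n \<beta>\<^sub>n)\<close> because \<open>\<surd>n \<beta>\<^sub>n\<close> diverges.

All these bounds are on expectations, so that Markov's inequality gives the convergence in
probability. The Gaussian case is an instance of the case of independent noise.\<close>

section \<open>Residuals on the common refinement of two segmentations\<close>

lemma sum_concat:
  fixes f :: "nat \<Rightarrow> 'b::comm_monoid_add"
  assumes "\<And>k. k \<le> m \<Longrightarrow> t k \<le> t (Suc k)"
  shows "(\<Sum>k=0..m. \<Sum>i=t k + 1..t (k + 1). f i) = (\<Sum>i=t 0 + 1..t (m + 1). f i)"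
  using assms
proof (induction m)
  case (Suc m)
  have "t 0 \<le> t (Suc m)"
    by (rule lift_Suc_mono_le[of "\<lambda>k. t (min k (Suc m))" 0 "Suc m", simplified])
       (use Suc.prems in \<open>auto simp: min_def not_less_eq_eq le_Suc_eq\<close>)
  moreover have "t (Suc m) \<le> t (Suc (Suc m))" using Suc.prems by auto
  ultimately have "{t 0 + 1..t (Suc m + 1)} = {t 0 + 1..t (m + 1)} \<union> {t (Suc m) + 1..t (Suc m + 1)}"
    by auto
  then have "(\<Sum>i=t 0 + 1..t (Suc m + 1). f i)
     = (\<Sum>i=t 0 + 1..t (m + 1). f i) + (\<Sum>i=t (Suc m) + 1..t (Suc m + 1). f i)"
    by (simp add: sum.union_disjoint)
  with Suc show ?case by simp
qed simp

text \<open>Both segmentations may be irregular, so the refinement is indexed by all pairs of segments and not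
by its sorted breakpoints; segments that do not meet contribute an empty interval.\<close>

lemma sum_refine:
  fixes f :: "nat \<Rightarrow> nat \<Rightarrow> 'b::comm_monoid_add"
  assumes t: "\<And>k. k \<le> m \<Longrightarrow> t k \<le> t (Suc k)"
    and s: "\<And>j. j \<le> m' \<Longrightarrow> s j \<le> s (Suc j)"
    and ends: "\<And>k. k \<le> m + 1 \<Longrightarrow> s 0 \<le> t k \<and> t k \<le> s (m' + 1)"
  shows "(\<Sum>k=0..m. \<Sum>i=t k + 1..t (k + 1). f k i) =
    (\<Sum>k=0..m. \<Sum>j=0..m'. \<Sum>i=max (t k) (s j) + 1..min (t (k + 1)) (s (j + 1)). f k i)"
proof (rule sum.cong[OF refl])
  fix k assume k: "k \<in> {0..m}"
  define p where "p j = min (t (k + 1)) (max (t k) (s j))" for j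
  have tk: "t k \<le> t (k + 1)" using t k by auto
  have e: "p 0 = t k" "p (m' + 1) = t (k + 1)"
    using ends[of k] ends[of "k + 1"] k tk by (auto simp: p_def)
  have "(\<Sum>i=t k + 1..t (k + 1). f k i) = (\<Sum>j=0..m'. \<Sum>i=p j + 1..p (j + 1). f k i)"
    unfolding e[symmetric]
  proof (rule sum_concat[of m' p "f k", symmetric])
    show "p j \<le> p (Suc j)" if "j \<le> m'" for j
      unfolding p_def using s[OF that] by (intro min.mono max.mono) simp_all
  qed
  also have "\<dots> = (\<Sum>j=0..m'. \<Sum>i=max (t k) (s j) + 1..min (t (k + 1)) (s (j + 1)). f k i)"
  proof (intro sum.cong refl)
    fix j assume "j \<in> {0..m'}"
    then have "s j \<le> s (j + 1)" using s by auto
    with tk show "{p j + 1..p (j + 1)} = {max (t k) (s j) + 1..min (t (k + 1)) (s (j + 1))}"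
      by (auto simp: p_def)
  qed
  finally show "(\<Sum>i=t k + 1..t (k + 1). f k i) =
    (\<Sum>j=0..m'. \<Sum>i=max (t k) (s j) + 1..min (t (k + 1)) (s (j + 1)). f k i)" .
qed

text \<open>The drop in the residual sum of squares of \<open>e\<close> when a free mean is fitted on \<open>{u + 1..v}\<close>. The
natural subtraction and division by zero make it vanish on empty intervals.\<close>

definition gain :: "(nat \<Rightarrow> real) \<Rightarrow> nat \<Rightarrow> nat \<Rightarrow> real" where
  "gain e u v = (\<Sum>i=u + 1..v. e i)\<^sup>2 / real (v - u)"

lemma gain_le_sum_squares: "gain e u v \<le> (\<Sum>i=u + 1..v. (e i)\<^sup>2)"
proof (cases "u < v")
  case True
  have "(\<Sum>i=u + 1..v. e i)\<^sup>2 \<le> real (v - u) * (\<Sum>i=u + 1..v. (e i)\<^sup>2)"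
    using sum_squared_le_sum_of_squares[of e "{u + 1..v}"] by (simp add: mult.commute)
  with True show ?thesis by (simp add: gain_def divide_simps mult.commute)
qed (simp add: gain_def sum_nonneg)

lemma gain_add_le: "gain (\<lambda>i. e i + u i) a b \<le> 2 * gain e a b + 2 * gain u a b"
proof -
  have "(x + y)\<^sup>2 / l \<le> 2 * (x\<^sup>2 / l) + 2 * (y\<^sup>2 / l)" if "l \<ge> 0" for x y l :: real
  proof -
    have "(x + y)\<^sup>2 \<le> 2 * x\<^sup>2 + 2 * y\<^sup>2"
      using zero_le_power2[of "x - y"] by (simp add: power2_eq_square algebra_simps)
    from divide_right_mono[OF this that] show ?thesis by (simp add: add_divide_distrib)
  qed
  then show ?thesis by (simp add: gain_def sum.distrib)
qed

text \<open>Completing the square: the cross term \<open>2 c \<Sum>e\<close> is at least \<open>- l c\<^sup>2 / 2 - 2 (\<Sum>e)\<^sup>2 / l\<close>, where \<open>l\<close> is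
the length. Giving up half of \<open>l c\<^sup>2\<close> (rather than all of it, which would give the sharp constant in
front of the gain) keeps a term that detects a wrong level \<open>c\<close>.\<close>

lemma sum_shifted_squares_ge:
  "(\<Sum>i=u + 1..v. (e i + c)\<^sup>2) \<ge>
     (\<Sum>i=u + 1..v. (e i)\<^sup>2) + real (v - u) * c\<^sup>2 / 2 - 2 * gain e u v"
proof (cases "u < v")
  case True
  define l S where "l = real (v - u)" and "S = (\<Sum>i=u + 1..v. e i)"
  have l: "l > 0" using True by (simp add: l_def)
  have "(\<Sum>i=u + 1..v. (e i + c)\<^sup>2) = (\<Sum>i=u + 1..v. (e i)\<^sup>2 + 2 * c * e i + c\<^sup>2)"
    by (intro sum.cong refl) (simp add: power2_sum algebra_simps)
  also have "\<dots> = (\<Sum>i=u + 1..v. (e i)\<^sup>2) + 2 * c * S + l * c\<^sup>2"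
    by (simp add: sum.distrib S_def l_def sum_distrib_left)
  finally have eq: "(\<Sum>i=u + 1..v. (e i + c)\<^sup>2) = (\<Sum>i=u + 1..v. (e i)\<^sup>2) + 2 * c * S + l * c\<^sup>2" .
  have "0 \<le> (l * c + 2 * S)\<^sup>2 / (2 * l)" using l by simp
  also have "\<dots> = l * c\<^sup>2 / 2 + 2 * c * S + 2 * (S\<^sup>2 / l)"
    using l by (simp add: power2_eq_square field_simps)
  finally show ?thesis unfolding eq gain_def S_def[symmetric] l_def[symmetric] by linarith
qed (simp add: gain_def)

text \<open>The one lower bound behind both kinds of error. On each piece where the fitted level and the true
level are constant, \<open>sum_shifted_squares_ge\<close> applies. Overfitting can only win the gains of the noise;
underfitting pays the squared distance between the true signal and the fit.\<close>

lemma residual_ss_ge: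
  assumes t: "t \<in> admissible D n m"
    and s: "\<And>j. j \<le> m' \<Longrightarrow> s j \<le> s (Suc j)" "s 0 = 0" "s (m' + 1) = n"
    and x: "\<And>j i. j \<le> m' \<Longrightarrow> s j < i \<Longrightarrow> i \<le> s (j + 1) \<Longrightarrow> x i - \<rho> * x (i - 1) = \<alpha> j + e i"
    and G: "\<And>k j. k \<le> m \<Longrightarrow> j \<le> m' \<Longrightarrow>
      gain e (max (t k) (s j)) (min (t (k + 1)) (s (j + 1))) \<le> G"
  shows "residual_ss m x \<rho> \<delta> t \<ge> (\<Sum>i=1..n. (e i)\<^sup>2)
    + (\<Sum>k=0..m. \<Sum>j=0..m'. real (min (t (k + 1)) (s (j + 1)) - max (t k) (s j)) * (\<alpha> j - \<delta> k)\<^sup>2) / 2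
    - 2 * real ((m + 1) * (m' + 1)) * G"
proof -
  have t0: "t 0 = 0" "t (m + 1) = n" using t by (auto simp: admissible_def)
  have tm: "t k \<le> t (Suc k)" if "k \<le> m" for k
  proof -
    have "Suc k \<in> {1..m + 1}" using that by auto
    with t have "t (Suc k - 1) < t (Suc k)" unfolding admissible_def by blast
    then show ?thesis by simp
  qed
  have ends: "s 0 \<le> t k \<and> t k \<le> s (m' + 1)" if "k \<le> m + 1" for k
    using admissible_le[OF t that] s by simp
  let ?u = "\<lambda>k j. max (t k) (s j)" and ?v = "\<lambda>k j. min (t (k + 1)) (s (j + 1))"
  have "(\<Sum>i=1..n. (e i)\<^sup>2) = (\<Sum>k=0..m. \<Sum>i=t k + 1..t (k + 1). (e i)\<^sup>2)"
    using sum_concat[of m t "\<lambda>i. (e i)\<^sup>2"] tm t0 by simp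
  also have "\<dots> = (\<Sum>k=0..m. \<Sum>j=0..m'. \<Sum>i=?u k j + 1..?v k j. (e i)\<^sup>2)"
    by (rule sum_refine) (use tm s(1) ends in blast)+
  finally have E: "(\<Sum>i=1..n. (e i)\<^sup>2) = (\<Sum>k=0..m. \<Sum>j=0..m'. \<Sum>i=?u k j + 1..?v k j. (e i)\<^sup>2)" .
  have "residual_ss m x \<rho> \<delta> t =
      (\<Sum>k=0..m. \<Sum>j=0..m'. \<Sum>i=?u k j + 1..?v k j. (x i - \<rho> * x (i - 1) - \<delta> k)\<^sup>2)"
    unfolding residual_ss_def by (rule sum_refine) (use tm s(1) ends in blast)+
  also have "\<dots> = (\<Sum>k=0..m. \<Sum>j=0..m'. \<Sum>i=?u k j + 1..?v k j. (e i + (\<alpha> j - \<delta> k))\<^sup>2)"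
  proof (intro sum.cong refl)
    fix k j i assume "k \<in> {0..m}" "j \<in> {0..m'}" "i \<in> {?u k j + 1..?v k j}"
    then have "x i - \<rho> * x (i - 1) = \<alpha> j + e i" by (intro x) auto
    then show "(x i - \<rho> * x (i - 1) - \<delta> k)\<^sup>2 = (e i + (\<alpha> j - \<delta> k))\<^sup>2"
      by (simp add: add_diff_eq add.commute)
  qed
  also have "\<dots> \<ge> (\<Sum>k=0..m. \<Sum>j=0..m'. (\<Sum>i=?u k j + 1..?v k j. (e i)\<^sup>2)
      + real (?v k j - ?u k j) * (\<alpha> j - \<delta> k)\<^sup>2 / 2 - 2 * G)"
  proof (intro sum_mono)
    fix k j assume "k \<in> {0..m}" "j \<in> {0..m'}"
    with G[of k j] sum_shifted_squares_ge[of e "?u k j" "?v k j" "\<alpha> j - \<delta> k"]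
    show "(\<Sum>i=?u k j + 1..?v k j. (e i)\<^sup>2) + real (?v k j - ?u k j) * (\<alpha> j - \<delta> k)\<^sup>2 / 2 - 2 * G
      \<le> (\<Sum>i=?u k j + 1..?v k j. (e i + (\<alpha> j - \<delta> k))\<^sup>2)"
      by (simp del: of_nat_diff)
  qed
  also have "(\<Sum>k=0..m. \<Sum>j=0..m'. (\<Sum>i=?u k j + 1..?v k j. (e i)\<^sup>2)
      + real (?v k j - ?u k j) * (\<alpha> j - \<delta> k)\<^sup>2 / 2 - 2 * G) =
      (\<Sum>k=0..m. \<Sum>j=0..m'. \<Sum>i=?u k j + 1..?v k j. (e i)\<^sup>2)
      + (\<Sum>k=0..m. \<Sum>j=0..m'. real (?v k j - ?u k j) * (\<alpha> j - \<delta> k)\<^sup>2) / 2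
      - (\<Sum>k=0..m. \<Sum>j=0..m'. 2 * G)"
    unfolding sum.distrib sum_subtractf sum_divide_distrib ..
  also have "(\<Sum>k=0..m. \<Sum>j=0..m'. 2 * G) = 2 * real ((m + 1) * (m' + 1)) * G"
    by (simp add: algebra_simps)
  finally show ?thesis unfolding E .
qed

lemma residual_ss_true:
  assumes s: "\<And>j. j \<le> m' \<Longrightarrow> s j \<le> s (Suc j)" "s 0 = 0" "s (m' + 1) = n"
    and x: "\<And>j i. j \<le> m' \<Longrightarrow> s j < i \<Longrightarrow> i \<le> s (j + 1) \<Longrightarrow> x i - \<rho> * x (i - 1) = \<alpha> j + e i"
  shows "residual_ss m' x \<rho> \<alpha> s = (\<Sum>i=1..n. (e i)\<^sup>2)"
proof -
  have "residual_ss m' x \<rho> \<alpha> s = (\<Sum>k=0..m'. \<Sum>i=s k + 1..s (k + 1). (e i)\<^sup>2)"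
    unfolding residual_ss_def
  proof (intro sum.cong refl)
    fix k i assume "k \<in> {0..m'}" "i \<in> {s k + 1..s (k + 1)}"
    then have "x i - \<rho> * x (i - 1) = \<alpha> k + e i" by (intro x) auto
    then show "(x i - \<rho> * x (i - 1) - \<alpha> k)\<^sup>2 = (e i)\<^sup>2" by simp
  qed
  also have "\<dots> = (\<Sum>i=1..n. (e i)\<^sup>2)" using sum_concat[of m' s] s by simp
  finally show ?thesis .
qed

section \<open>The cost of missing a change-point\<close>

text \<open>The windows of radius \<open>w\<close> around the \<open>m'\<close> true change-points are disjoint, so \<open>m < m'\<close> breakpoints
leave one of them empty, and this window lies inside a single fitted segment.\<close>

lemma missed_change_point:
  assumes t: "t \<in> admissible D n m" and m: "m < m'"
    and s: "s 0 = 0" "s (m' + 1) = n"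
    and gap: "\<And>j. j \<le> m' \<Longrightarrow> s j + 2 * w \<le> s (Suc j)" and w: "w > 0"
  obtains j k where "1 \<le> j" "j \<le> m'" "k \<le> m" "t k + w \<le> s j" "s j + w \<le> t (k + 1)"
proof -
  have mono: "s i \<le> s j" if "i \<le> j" "j \<le> m' + 1" for i j
    using that
  proof (induction j)
    case (Suc j)
    then show ?case using gap[of j] by (cases "i = Suc j") auto
  qed simp
  have gap': "s i + 2 * w \<le> s j" if "i < j" "j \<le> m' + 1" for i j
    using gap[of i] mono[of "Suc i" j] that by auto
  have "\<exists>j\<in>{1..m'}. \<forall>k\<in>{1..m}. t k + w \<le> s j \<or> s j + w \<le> t k"
  proof (rule ccontr)
    assume "\<not> ?thesis"
    then have "\<exists>k. k \<in> {1..m} \<and> s j < t k + w \<and> t k < s j + w" if "j \<in> {1..m'}" for j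
      using that by (meson not_le)
    then obtain f where f: "\<And>j. j \<in> {1..m'} \<Longrightarrow> f j \<in> {1..m} \<and> s j < t (f j) + w \<and> t (f j) < s j + w"
      by metis
    have "inj_on f {1..m'}"
    proof (rule linorder_inj_onI')
      fix i j assume ij: "i \<in> {1..m'}" "j \<in> {1..m'}" "i < j"
      show "f i \<noteq> f j" using f[OF ij(1)] f[OF ij(2)] gap'[of i j] ij by auto
    qed
    moreover have "f ` {1..m'} \<subseteq> {1..m}" using f by blast
    ultimately have "card {1..m'} \<le> card {1..m}" by (intro card_inj_on_le) auto
    with m show False by simp
  qed
  then obtain j where j: "j \<in> {1..m'}" "\<And>k. k \<in> {1..m} \<Longrightarrow> t k + w \<le> s j \<or> s j + w \<le> t k"
    by blast
  have t0: "t 0 = 0" "t (m + 1) = n" using t by (auto simp: admissible_def)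
  have far: "t k + w \<le> s j \<or> s j + w \<le> t k" if "k \<le> m + 1" for k
  proof -
    have "k = 0 \<or> k = m + 1 \<or> k \<in> {1..m}" using that by auto
    then show ?thesis
    proof (elim disjE)
      assume "k \<in> {1..m}"
      then show ?thesis by (rule j(2))
    qed (use j t0 s gap'[of 0 j] gap'[of j "m' + 1"] in auto)
  qed
  have n: "s j < n" using gap'[of j "m' + 1"] j s w by auto
  \<comment> \<open>the fitted segment that contains the observations on both sides of \<open>s j\<close>\<close>
  define k where "k = (GREATEST k. k \<le> m \<and> t k \<le> s j)"
  have k: "k \<le> m \<and> t k \<le> s j"
    unfolding k_def by (rule GreatestI_nat[where b = m and k = 0]) (auto simp: t0)
  have "s j < t (k + 1)"
  proof (rule ccontr)
    assume "\<not> ?thesis"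
    moreover have "k \<noteq> m" using calculation n t0 by auto
    ultimately have "k + 1 \<le> k"
      unfolding k_def using k by (intro Greatest_le_nat[where b = m]) (auto simp flip: k_def)
    then show False by simp
  qed
  with k far[of k] far[of "k + 1"] w have "t k + w \<le> s j" "s j + w \<le> t (k + 1)" by auto
  with that j k show ?thesis by auto
qed

text \<open>Across an empty window one fitted level has to serve two true levels, and
\<open>(a - b)\<^sup>2 \<le> 2 (a - d)\<^sup>2 + 2 (b - d)\<^sup>2\<close>.\<close>

lemma missed_change_point_cost:
  fixes \<alpha> \<delta> :: "nat \<Rightarrow> real"
  assumes t: "t \<in> admissible D n m" and m: "m < m'"
    and s: "s 0 = 0" "s (m' + 1) = n"
    and gap: "\<And>j. j \<le> m' \<Longrightarrow> s j + 2 * w \<le> s (Suc j)" and w: "w > 0"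
    and h: "\<And>j. 1 \<le> j \<Longrightarrow> j \<le> m' \<Longrightarrow> h \<le> (\<alpha> j - \<alpha> (j - 1))\<^sup>2"
  shows "(\<Sum>k=0..m. \<Sum>j=0..m'. real (min (t (k + 1)) (s (j + 1)) - max (t k) (s j)) * (\<alpha> j - \<delta> k)\<^sup>2)
     \<ge> real w * h / 2"
proof -
  obtain j k where jk: "1 \<le> j" "j \<le> m'" "k \<le> m" "t k + w \<le> s j" "s j + w \<le> t (k + 1)"
    using missed_change_point[OF t m s gap w] by blast
  let ?f = "\<lambda>k j. real (min (t (k + 1)) (s (j + 1)) - max (t k) (s j)) * (\<alpha> j - \<delta> k)\<^sup>2"
  have "h \<le> (\<alpha> j - \<alpha> (j - 1))\<^sup>2" using h jk by auto
  also have "\<dots> \<le> 2 * ((\<alpha> (j - 1) - \<delta> k)\<^sup>2 + (\<alpha> j - \<delta> k)\<^sup>2)"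
    using zero_le_power2[of "\<alpha> (j - 1) + \<alpha> j - 2 * \<delta> k"] by (simp add: power2_eq_square algebra_simps)
  finally have "real w * h / 2 \<le> real w * (\<alpha> (j - 1) - \<delta> k)\<^sup>2 + real w * (\<alpha> j - \<delta> k)\<^sup>2"
    using mult_left_mono[of h "2 * ((\<alpha> (j - 1) - \<delta> k)\<^sup>2 + (\<alpha> j - \<delta> k)\<^sup>2)" "real w"]
    by (simp add: algebra_simps)
  also have "\<dots> \<le> ?f k (j - 1) + ?f k j"
  proof -
    have "j - 1 \<le> m'" "Suc (j - 1) = j" using jk by auto
    with gap[of "j - 1"] have "s (j - 1) + 2 * w \<le> s j" by simp
    with gap[of j] jk have "w \<le> min (t (k + 1)) (s (j - 1 + 1)) - max (t k) (s (j - 1))"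
      "w \<le> min (t (k + 1)) (s (j + 1)) - max (t k) (s j)" by auto
    then show ?thesis by (intro add_mono mult_right_mono) (simp_all only: of_nat_le_iff zero_le_power2)
  qed
  also have "\<dots> = (\<Sum>j\<in>{j - 1, j}. ?f k j)" using jk by auto
  also have "\<dots> \<le> (\<Sum>j=0..m'. ?f k j)" using jk by (intro sum_mono2) auto
  also have "\<dots> \<le> (\<Sum>k=0..m. \<Sum>j=0..m'. ?f k j)"
    using jk by (intro member_le_sum[of k "{0..m}" "\<lambda>k. \<Sum>j=0..m'. ?f k j"] sum_nonneg) auto
  finally show ?thesis .
qed

section \<open>Gains on long intervals are controlled by block maxima\<close>

text \<open>The running maximum of the absolute partial sums of \<open>f\<close>. It is a recursive functional of the
sequence, so that its dependence on the first \<open>k\<close> terms only, its measurability and its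
integrability all follow by induction.\<close>

primrec run_max :: "(nat \<Rightarrow> real) \<Rightarrow> nat \<Rightarrow> real" where
  "run_max f 0 = 0"
| "run_max f (Suc k) = max (run_max f k) \<bar>\<Sum>i<Suc k. f i\<bar>"

lemma run_max_nonneg: "run_max f k \<ge> 0"
  by (induction k) auto

lemma abs_sum_le_run_max: "k \<le> K \<Longrightarrow> \<bar>\<Sum>i<k. f i\<bar> \<le> run_max f K"
  by (induction K) (auto simp: le_Suc_eq max.coboundedI1 simp del: sum.lessThan_Suc)

lemma run_max_cong: "(\<And>i. i < k \<Longrightarrow> f i = g i) \<Longrightarrow> run_max f k = run_max g k"
  by (induction k) (auto intro!: arg_cong2[where f = max] arg_cong[where f = abs] sum.cong)

text \<open>The blocks \<open>{b D + 1..b D + D}\<close> cover \<open>{1..n}\<close>. For centred independent noise the expected squared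
maximum over a block is of order \<open>D\<close>, so that this quantity has an expectation of order \<open>n / D + 1\<close>.\<close>

definition block_max :: "nat \<Rightarrow> nat \<Rightarrow> (nat \<Rightarrow> real) \<Rightarrow> real" where
  "block_max D n e = 12 / real D * (\<Sum>b=0..n div D. (run_max (\<lambda>i. e (b * D + 1 + i)) D)\<^sup>2)"

text \<open>An interval of length \<open>l \<ge> D\<close> meets at most \<open>l / D + 2 \<le> 3 l / D\<close> blocks. Its sum over each of these
is a difference of two partial sums of the block, hence at most twice the block maximum, and the
Cauchy-Schwarz inequality over the blocks turns their number into the factor \<open>l\<close> that the gain
divides out. The factor 12 in the bound is 3, from the count, times the square of 2. So one random variable bounds the gains of all intervals of length at least \<open>D\<close>.\<close>

lemma gain_le_block_max:
  assumes D: "0 < D" "D \<le> v - u" and v: "v \<le> n"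
  shows "gain e u v \<le> block_max D n e"
proof -
  define N where "N = n div D"
  define M where "M b = run_max (\<lambda>i. e (b * D + 1 + i)) D" for b
  define p where "p b = min v (max u (b * D))" for b
  define B where "B = {b\<in>{0..N}. u < (b + 1) * D \<and> b * D < v}"
  have uv: "u < v" using D by auto
  have "n < (N + 1) * D" using D(1) unfolding N_def
    by (metis Suc_eq_plus1 dividend_less_div_times mult_Suc add.commute)
  then have p: "p 0 = u" "p (N + 1) = v" using uv v by (auto simp: p_def)
  have "(\<Sum>i=u + 1..v. e i) = (\<Sum>b=0..N. \<Sum>i=p b + 1..p (b + 1). e i)"
    unfolding p[symmetric] by (subst sum_concat) (auto simp: p_def min_def max_def)
  also have "\<dots> = (\<Sum>b\<in>B. \<Sum>i=p b + 1..p (b + 1). e i)"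
  proof (rule sum.mono_neutral_right)
    show "\<forall>b\<in>{0..N} - B. (\<Sum>i=p b + 1..p (b + 1). e i) = 0"
      by (auto simp: B_def p_def not_less intro!: sum.neutral)
  qed (auto simp: B_def)
  finally have split: "(\<Sum>i=u + 1..v. e i) = (\<Sum>b\<in>B. \<Sum>i=p b + 1..p (b + 1). e i)" .
  have part: "(\<Sum>i=p b + 1..p (b + 1). e i)\<^sup>2 \<le> 4 * (M b)\<^sup>2" if b: "b \<in> B" for b
  proof -
    have le: "b * D \<le> p b" "p b \<le> p (b + 1)" "p (b + 1) \<le> b * D + D"
      using b uv by (auto simp: B_def p_def)
    define k l where "k = p b - b * D" and "l = p (b + 1) - b * D"
    have kl: "p b = b * D + k" "p (b + 1) = b * D + l" "k \<le> l" "l \<le> D"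
      using le by (auto simp: k_def l_def)
    have "(\<Sum>i=p b + 1..p (b + 1). e i) = (\<Sum>i=k..<l. e (b * D + 1 + i))"
      unfolding kl
      by (rule sum.reindex_bij_witness[of _ "\<lambda>i. b * D + 1 + i" "\<lambda>i. i - (b * D + 1)"]) auto
    also have "\<dots> = (\<Sum>i<l. e (b * D + 1 + i)) - (\<Sum>i<k. e (b * D + 1 + i))"
      using kl sum_diff_nat_ivl[of 0 k l "\<lambda>i. e (b * D + 1 + i)"] by (simp add: atLeast0LessThan)
    finally have "\<bar>\<Sum>i=p b + 1..p (b + 1). e i\<bar> \<le> 2 * M b"
      using abs_sum_le_run_max[of l D "\<lambda>i. e (b * D + 1 + i)"]
        abs_sum_le_run_max[of k D "\<lambda>i. e (b * D + 1 + i)"] kl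
      unfolding M_def by linarith
    then have "\<bar>\<Sum>i=p b + 1..p (b + 1). e i\<bar>\<^sup>2 \<le> (2 * M b)\<^sup>2" by (intro power_mono) auto
    then show ?thesis by (simp add: power_mult_distrib)
  qed
  have "real (card B) * real D \<le> 3 * real (v - u)"
  proof -
    have "B \<subseteq> {u div D..(v - 1) div D}"
      using D(1) by (auto simp: B_def less_Suc_eq_le[symmetric] div_less_iff_less_mult)
         (auto simp: less_Suc_eq_le less_eq_div_iff_mult_less_eq)
    from card_mono[OF _ this] have "card B \<le> Suc ((v - 1) div D) - u div D" by simp
    then have "card B * D \<le> (Suc ((v - 1) div D) - u div D) * D" by simp
    also have "\<dots> = D + (v - 1) div D * D - u div D * D" by (simp add: diff_mult_distrib)
    also have "\<dots> \<le> 3 * (v - u)"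
      using div_times_less_eq_dividend[of "v - 1" D] dividend_less_div_times[of D u] D uv by linarith
    finally show ?thesis by (metis of_nat_le_iff of_nat_mult of_nat_numeral)
  qed
  then have card: "real (card B) \<le> 3 * real (v - u) / real D" using D by (simp add: field_simps)
  have "(\<Sum>i=u + 1..v. e i)\<^sup>2 \<le> real (card B) * (\<Sum>b\<in>B. (\<Sum>i=p b + 1..p (b + 1). e i)\<^sup>2)"
    unfolding split by (rule order_trans[OF sum_squared_le_sum_of_squares]) simp
  also have "\<dots> \<le> 3 * real (v - u) / real D * (\<Sum>b=0..N. 4 * (M b)\<^sup>2)"
  proof (rule mult_mono[OF card])
    have "(\<Sum>b\<in>B. (\<Sum>i=p b + 1..p (b + 1). e i)\<^sup>2) \<le> (\<Sum>b\<in>B. 4 * (M b)\<^sup>2)"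
      by (rule sum_mono[OF part])
    also have "\<dots> \<le> (\<Sum>b=0..N. 4 * (M b)\<^sup>2)" by (rule sum_mono2) (auto simp: B_def)
    finally show "(\<Sum>b\<in>B. (\<Sum>i=p b + 1..p (b + 1). e i)\<^sup>2) \<le> (\<Sum>b=0..N. 4 * (M b)\<^sup>2)" .
  qed (auto intro: sum_nonneg)
  also have "\<dots> = real (v - u) * block_max D n e"
    by (simp add: block_max_def M_def N_def sum_distrib_left mult_ac)
  finally show ?thesis using uv by (simp add: gain_def divide_simps mult.commute)
qed

section \<open>An L2 maximal inequality for independent centred variables\<close>

text \<open>Doob's L2 inequality in a deterministic form: the sum is a martingale transform, so that taking
expectations removes it. The proof bounds the transform by \<open>R \<bar>S\<bar> - R\<^sup>2 / 2\<close>, where \<open>R\<close> is the running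
maximum and \<open>S\<close> the partial sum: \<open>sgn S\<close> is a subgradient of the absolute value, and \<open>R\<close> changes only
when \<open>R = \<bar>S\<bar>\<close>. The claim is then \<open>(R - 2 \<bar>S\<bar>)\<^sup>2 \<ge> 0\<close>.\<close>

lemma run_max_pathwise:
  fixes f :: "nat \<Rightarrow> real"
  defines "S \<equiv> \<lambda>k. \<Sum>i<k. f i"
  shows "(run_max f n)\<^sup>2 + 4 * (\<Sum>k<n. run_max f k * sgn (S k) * f k) \<le> 4 * (S n)\<^sup>2"
proof -
  have inv: "(\<Sum>k<n. run_max f k * sgn (S k) * f k) \<le> run_max f n * \<bar>S n\<bar> - (run_max f n)\<^sup>2 / 2"
  proof (induction n)
    case (Suc n)
    define X X' m m' where "X = \<bar>S n\<bar>" and "X' = \<bar>S (Suc n)\<bar>" and "m = run_max f n" 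
      and "m' = run_max f (Suc n)"
    have m': "m' = max m X'" by (simp add: m'_def m_def X'_def S_def)
    have m0: "m \<ge> 0" by (simp add: m_def run_max_nonneg)
    have "sgn (S n) * f n \<le> X' - X"
      unfolding X_def X'_def S_def by (auto simp: sgn_if)
    then have "m * (sgn (S n) * f n) \<le> m * (X' - X)" by (rule mult_left_mono[OF _ m0])
    moreover have "(\<Sum>k<n. run_max f k * sgn (S k) * f k) \<le> m * X - m\<^sup>2 / 2"
      using Suc by (simp add: m_def X_def)
    ultimately have "(\<Sum>k<Suc n. run_max f k * sgn (S k) * f k) \<le> m * X' - m\<^sup>2 / 2"
      by (simp add: m_def[symmetric] algebra_simps)
    also have "\<dots> \<le> m' * X' - m'\<^sup>2 / 2"
    proof (cases "X' \<le> m")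
      case False
      then show ?thesis using zero_le_power2[of "m - X'"] m'
        by (simp add: power2_eq_square algebra_simps)
    qed (simp add: m')
    finally show ?case by (simp add: m'_def X'_def)
  qed simp
  have "0 \<le> (run_max f n - 2 * \<bar>S n\<bar>)\<^sup>2" by simp
  then have "4 * (run_max f n * \<bar>S n\<bar>) - (run_max f n)\<^sup>2 \<le> 4 * (S n)\<^sup>2"
    by (simp add: power2_diff algebra_simps)
  with inv show ?thesis by linarith
qed

lemma (in prob_space) expectation_mult_independent_centred:
  fixes X :: "'i \<Rightarrow> 'a \<Rightarrow> real"
  assumes indep: "indep_vars (\<lambda>_. borel) X I" and A: "A \<subseteq> I" "b \<in> I" "b \<notin> A"
    and F: "F \<in> borel_measurable (PiM A (\<lambda>_. borel))"
    and G: "\<And>\<omega>. G \<omega> = F (restrict (\<lambda>i. X i \<omega>) A)"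
    and int: "integrable M G" "integrable M (X b)" and mean: "expectation (X b) = 0"
  shows "integrable M (\<lambda>\<omega>. G \<omega> * X b \<omega>)" "expectation (\<lambda>\<omega>. G \<omega> * X b \<omega>) = 0"
proof -
  have "indep_var borel (F \<circ> (\<lambda>\<omega>. restrict (\<lambda>i. X i \<omega>) A)) borel ((\<lambda>f. f b) \<circ> (\<lambda>\<omega>. restrict (\<lambda>i. X i \<omega>) {b}))"
    using A F by (intro indep_var_compose[OF indep_var_restrict[OF indep]]) auto
  moreover have "F \<circ> (\<lambda>\<omega>. restrict (\<lambda>i. X i \<omega>) A) = G" using G by (simp add: fun_eq_iff)
  moreover have "(\<lambda>f. f b) \<circ> (\<lambda>\<omega>. restrict (\<lambda>i. X i \<omega>) {b}) = X b" by (simp add: fun_eq_iff)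
  ultimately have iv: "indep_var borel G borel (X b)" by simp
  show "integrable M (\<lambda>\<omega>. G \<omega> * X b \<omega>)" by (rule indep_var_integrable[OF iv int])
  show "expectation (\<lambda>\<omega>. G \<omega> * X b \<omega>) = 0"
    using indep_var_lebesgue_integral[OF iv int] mean by simp
qed

lemma measurable_sum_path:
  "k \<le> K \<Longrightarrow> (\<lambda>f. \<Sum>i<k. f (a + int i)) \<in> borel_measurable (PiM {a..<a + int K} (\<lambda>_. borel :: real measure))"
  by (intro borel_measurable_sum measurable_component_singleton) auto

lemma measurable_run_max_path:
  "k \<le> K \<Longrightarrow> (\<lambda>f. run_max (\<lambda>i. f (a + int i)) k)
     \<in> borel_measurable (PiM {a..<a + int K} (\<lambda>_. borel :: real measure))"
proof (induction k)
  case (Suc k)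
  show ?case
    unfolding run_max.simps using Suc
    by (intro borel_measurable_max borel_measurable_abs measurable_sum_path) auto
qed simp

text \<open>The factor \<open>R sgn S\<close> of each increment in the pathwise inequality depends on the earlier variables
only, so that every term of the transform has expectation zero, and \<open>4 E S\<^sup>2\<close> remains.\<close>

lemma (in prob_space) run_max_L2:
  fixes \<epsilon> :: "int \<Rightarrow> 'a \<Rightarrow> real"
  assumes indep: "indep_vars (\<lambda>_. borel) \<epsilon> UNIV"
    and sq: "\<And>i. integrable M (\<lambda>\<omega>. (\<epsilon> i \<omega>)\<^sup>2)"
    and mean: "\<And>i. expectation (\<epsilon> i) = 0"
    and var: "\<And>i. expectation (\<lambda>\<omega>. (\<epsilon> i \<omega>)\<^sup>2) = \<sigma>\<^sup>2"
  shows "integrable M (\<lambda>\<omega>. (run_max (\<lambda>i. \<epsilon> (a + int i) \<omega>) n)\<^sup>2)" (is "integrable M (\<lambda>\<omega>. (?R \<omega> n)\<^sup>2)")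
    and "expectation (\<lambda>\<omega>. (run_max (\<lambda>i. \<epsilon> (a + int i) \<omega>) n)\<^sup>2) \<le> 4 * real n * \<sigma>\<^sup>2"
proof -
  have [measurable]: "\<epsilon> i \<in> borel_measurable M" for i
    using indep by (simp add: indep_vars_def)
  have int: "integrable M (\<epsilon> i)" for i by (rule square_integrable_imp_integrable[OF _ sq]) simp
  define S where "S k \<omega> = (\<Sum>i<k. \<epsilon> (a + int i) \<omega>)" for k \<omega>
  have [measurable]: "S k \<in> borel_measurable M" for k unfolding S_def by measurable
  have [measurable]: "(\<lambda>\<omega>. ?R \<omega> k) \<in> borel_measurable M" for k
    by (induction k) simp_all
  have next_indep: "integrable M (\<lambda>\<omega>. G \<omega> * \<epsilon> (a + int k) \<omega>)"
      "expectation (\<lambda>\<omega>. G \<omega> * \<epsilon> (a + int k) \<omega>) = 0"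
    if "F \<in> borel_measurable (PiM {a..<a + int k} (\<lambda>_. borel))"
      "\<And>\<omega>. G \<omega> = F (restrict (\<lambda>i. \<epsilon> i \<omega>) {a..<a + int k})" "integrable M G" for F G k
    by (rule expectation_mult_independent_centred[OF indep _ _ _ that int mean]; simp)+
  have S2: "integrable M (\<lambda>\<omega>. (S k \<omega>)\<^sup>2) \<and> expectation (\<lambda>\<omega>. (S k \<omega>)\<^sup>2) = real k * \<sigma>\<^sup>2" for k
  proof (induction k)
    case (Suc k)
    have Si: "integrable M (S k)" by (rule square_integrable_imp_integrable) (use Suc in auto)
    have x: "integrable M (\<lambda>\<omega>. S k \<omega> * \<epsilon> (a + int k) \<omega>)"
        "expectation (\<lambda>\<omega>. S k \<omega> * \<epsilon> (a + int k) \<omega>) = 0"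
      by (rule next_indep[OF measurable_sum_path[OF order_refl] _ Si], simp add: S_def)+
    have eq: "(S (Suc k) \<omega>)\<^sup>2 = (S k \<omega>)\<^sup>2 + 2 * (S k \<omega> * \<epsilon> (a + int k) \<omega>) + (\<epsilon> (a + int k) \<omega>)\<^sup>2" for \<omega>
      by (simp add: S_def power2_eq_square algebra_simps)
    show ?case unfolding eq using Suc x sq var by (simp add: algebra_simps)
  qed (simp add: S_def)
  have R2: "integrable M (\<lambda>\<omega>. (?R \<omega> k)\<^sup>2)" for k
  proof (induction k)
    case (Suc k)
    show ?case
    proof (rule Bochner_Integration.integrable_bound)
      show "integrable M (\<lambda>\<omega>. (?R \<omega> k)\<^sup>2 + (S (Suc k) \<omega>)\<^sup>2)" using Suc S2 by auto
      show "AE \<omega> in M. norm ((?R \<omega> (Suc k))\<^sup>2) \<le> norm ((?R \<omega> k)\<^sup>2 + (S (Suc k) \<omega>)\<^sup>2)"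
        unfolding run_max.simps S_def[symmetric] by (auto simp: max_def)
    qed measurable
  qed simp
  then show "integrable M (\<lambda>\<omega>. (?R \<omega> n)\<^sup>2)" .
  define G where "G k \<omega> = ?R \<omega> k * sgn (S k \<omega>)" for k \<omega>
  have Gx: "integrable M (\<lambda>\<omega>. G k \<omega> * \<epsilon> (a + int k) \<omega>)"
      "expectation (\<lambda>\<omega>. G k \<omega> * \<epsilon> (a + int k) \<omega>) = 0" for k
  proof -
    have Ri: "integrable M (\<lambda>\<omega>. ?R \<omega> k)" by (rule square_integrable_imp_integrable[OF _ R2]) simp
    have [measurable]: "G k \<in> borel_measurable M" unfolding G_def[abs_def] by measurable
    have Gi: "integrable M (G k)"
      by (rule Bochner_Integration.integrable_bound[OF Ri]) (auto simp: G_def abs_mult sgn_if)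
    have F: "(\<lambda>f. run_max (\<lambda>i. f (a + int i)) k * sgn (\<Sum>i<k. f (a + int i)))
        \<in> borel_measurable (PiM {a..<a + int k} (\<lambda>_. borel))"
      by (intro borel_measurable_times measurable_run_max_path[OF order_refl]
          measurable_compose[OF measurable_sum_path[OF order_refl] borel_measurable_sgn])
    have e: "G k \<omega> = (\<lambda>f. run_max (\<lambda>i. f (a + int i)) k * sgn (\<Sum>i<k. f (a + int i)))
        (restrict (\<lambda>i. \<epsilon> i \<omega>) {a..<a + int k})" for \<omega>
      unfolding G_def S_def by (auto intro!: arg_cong2[where f = times] run_max_cong)
    show "integrable M (\<lambda>\<omega>. G k \<omega> * \<epsilon> (a + int k) \<omega>)"
      "expectation (\<lambda>\<omega>. G k \<omega> * \<epsilon> (a + int k) \<omega>) = 0"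
      by (rule next_indep[OF F e Gi])+
  qed
  have "expectation (\<lambda>\<omega>. (?R \<omega> n)\<^sup>2) =
      expectation (\<lambda>\<omega>. (?R \<omega> n)\<^sup>2 + 4 * (\<Sum>k<n. G k \<omega> * \<epsilon> (a + int k) \<omega>))"
    using R2 Gx by simp
  also have "\<dots> \<le> expectation (\<lambda>\<omega>. 4 * (S n \<omega>)\<^sup>2)"
  proof (rule integral_mono)
    show "integrable M (\<lambda>\<omega>. (?R \<omega> n)\<^sup>2 + 4 * (\<Sum>k<n. G k \<omega> * \<epsilon> (a + int k) \<omega>))"
      using R2 Gx by simp
    show "integrable M (\<lambda>\<omega>. 4 * (S n \<omega>)\<^sup>2)" using S2 by simp
    show "(?R \<omega> n)\<^sup>2 + 4 * (\<Sum>k<n. G k \<omega> * \<epsilon> (a + int k) \<omega>) \<le> 4 * (S n \<omega>)\<^sup>2" for \<omega>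
      using run_max_pathwise[of "\<lambda>i. \<epsilon> (a + int i) \<omega>" n] by (simp add: G_def S_def)
  qed
  also have "\<dots> = 4 * real n * \<sigma>\<^sup>2" using S2 by simp
  finally show "expectation (\<lambda>\<omega>. (?R \<omega> n)\<^sup>2) \<le> 4 * real n * \<sigma>\<^sup>2" .
qed

section \<open>The stationary autoregressive process\<close>

text \<open>Cauchy-Schwarz with the weights \<open>\<bar>\<rho>\<bar> ^ j\<close>, whose total mass is at most \<open>1 / (1 - \<bar>\<rho>\<bar>)\<close>.\<close>

lemma weighted_sum_power_squared_le:
  fixes \<rho> :: real
  assumes "\<bar>\<rho>\<bar> < 1"
  shows "(\<Sum>j<N. \<rho> ^ j * x j)\<^sup>2 \<le> (\<Sum>j<N. \<bar>\<rho>\<bar> ^ j * (x j)\<^sup>2) / (1 - \<bar>\<rho>\<bar>)"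
proof -
  have geo: "(\<Sum>j<N. \<bar>\<rho>\<bar> ^ j) \<le> 1 / (1 - \<bar>\<rho>\<bar>)"
    using assms by (simp add: sum_gp_strict divide_right_mono)
  have "\<bar>\<Sum>j<N. \<rho> ^ j * x j\<bar> \<le> (\<Sum>j<N. \<bar>\<rho> ^ j * x j\<bar>)" by (rule sum_abs)
  also have "\<dots> = (\<Sum>j<N. sqrt (\<bar>\<rho>\<bar> ^ j) * (sqrt (\<bar>\<rho>\<bar> ^ j) * \<bar>x j\<bar>))"
    by (intro sum.cong refl) (simp add: abs_mult power_abs flip: mult.assoc)
  finally have "(\<Sum>j<N. \<rho> ^ j * x j)\<^sup>2 \<le> (\<Sum>j<N. sqrt (\<bar>\<rho>\<bar> ^ j) * (sqrt (\<bar>\<rho>\<bar> ^ j) * \<bar>x j\<bar>))\<^sup>2"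
    by (rule abs_le_square_iff[THEN iffD1, OF order_trans[OF _ abs_ge_self]])
  also have "\<dots> \<le> (\<Sum>j<N. (sqrt (\<bar>\<rho>\<bar> ^ j))\<^sup>2) * (\<Sum>j<N. (sqrt (\<bar>\<rho>\<bar> ^ j) * \<bar>x j\<bar>)\<^sup>2)"
    by (rule Cauchy_Schwarz_ineq_sum)
  also have "\<dots> = (\<Sum>j<N. \<bar>\<rho>\<bar> ^ j) * (\<Sum>j<N. \<bar>\<rho>\<bar> ^ j * (x j)\<^sup>2)"
    by (simp add: power_mult_distrib)
  also have "\<dots> \<le> 1 / (1 - \<bar>\<rho>\<bar>) * (\<Sum>j<N. \<bar>\<rho>\<bar> ^ j * (x j)\<^sup>2)"
    by (intro mult_right_mono geo sum_nonneg) auto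
  finally show ?thesis by simp
qed

text \<open>The partial sums of the defining series have uniformly bounded second moments by the weighted
Cauchy-Schwarz inequality, and Fatou's lemma passes to the limit. The bound is cruder than the exact
value \<open>\<sigma>\<^sup>2 / (1 - \<rho>\<^sup>2)\<close>, but only its being finite and uniform in \<open>i\<close> matters here.\<close>

lemma (in prob_space) ar1_second_moment:
  assumes ar: "stationary_ar1 M \<rho> \<epsilon> \<eta>" and \<rho>: "\<bar>\<rho>\<bar> < 1"
    and [measurable]: "\<And>i. \<epsilon> i \<in> borel_measurable M"
    and sq: "\<And>i. integrable M (\<lambda>\<omega>. (\<epsilon> i \<omega>)\<^sup>2)"
    and var: "\<And>i. expectation (\<lambda>\<omega>. (\<epsilon> i \<omega>)\<^sup>2) = \<sigma>\<^sup>2"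
  shows "integrable M (\<lambda>\<omega>. (\<eta> i \<omega>)\<^sup>2)"
    and "expectation (\<lambda>\<omega>. (\<eta> i \<omega>)\<^sup>2) \<le> \<sigma>\<^sup>2 / (1 - \<bar>\<rho>\<bar>)\<^sup>2"
proof -
  have [measurable]: "\<eta> i \<in> borel_measurable M" for i using ar by (simp add: stationary_ar1_def)
  define K where "K = \<sigma>\<^sup>2 / (1 - \<bar>\<rho>\<bar>)\<^sup>2"
  define S where "S N \<omega> = (\<Sum>j<N. \<rho> ^ j * \<epsilon> (i - int j) \<omega>)" for N \<omega>
  have [measurable]: "S N \<in> borel_measurable M" for N unfolding S_def by measurable
  have bound: "(\<integral>\<^sup>+\<omega>. ennreal ((S N \<omega>)\<^sup>2) \<partial>M) \<le> ennreal K" for N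
  proof -
    let ?B = "\<lambda>\<omega>. (\<Sum>j<N. \<bar>\<rho>\<bar> ^ j * (\<epsilon> (i - int j) \<omega>)\<^sup>2) / (1 - \<bar>\<rho>\<bar>)"
    have B: "integrable M ?B" using sq by simp
    have "expectation ?B = (\<Sum>j<N. \<bar>\<rho>\<bar> ^ j) * \<sigma>\<^sup>2 / (1 - \<bar>\<rho>\<bar>)"
      using sq var by (simp add: sum_distrib_right)
    also have "\<dots> \<le> 1 / (1 - \<bar>\<rho>\<bar>) * \<sigma>\<^sup>2 / (1 - \<bar>\<rho>\<bar>)"
      using \<rho> by (intro divide_right_mono mult_right_mono) (auto simp: sum_gp_strict divide_right_mono)
    also have "\<dots> = K" by (simp add: K_def power2_eq_square)
    finally have EB: "expectation ?B \<le> K" .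
    have "(\<integral>\<^sup>+\<omega>. ennreal ((S N \<omega>)\<^sup>2) \<partial>M) \<le> (\<integral>\<^sup>+\<omega>. ennreal (?B \<omega>) \<partial>M)"
      unfolding S_def by (intro nn_integral_mono ennreal_leI weighted_sum_power_squared_le \<rho>)
    also have "\<dots> = ennreal (expectation ?B)"
      using \<rho> by (intro nn_integral_eq_integral[OF B] AE_I2 divide_nonneg_pos sum_nonneg) auto
    also have "\<dots> \<le> ennreal K" by (rule ennreal_leI[OF EB])
    finally show ?thesis .
  qed
  have "AE \<omega> in M. (\<lambda>j. \<rho> ^ j * \<epsilon> (i - int j) \<omega>) sums \<eta> i \<omega>"
    using ar by (simp add: stationary_ar1_def)
  then have "AE \<omega> in M. ennreal ((\<eta> i \<omega>)\<^sup>2) = liminf (\<lambda>N. ennreal ((S N \<omega>)\<^sup>2))"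
  proof eventually_elim
    case (elim \<omega>)
    then have "(\<lambda>N. ennreal ((S N \<omega>)\<^sup>2)) \<longlonglongrightarrow> ennreal ((\<eta> i \<omega>)\<^sup>2)"
      unfolding sums_def S_def by (intro tendsto_intros)
    from lim_imp_Liminf[OF _ this] show ?case by simp
  qed
  then have "(\<integral>\<^sup>+\<omega>. ennreal ((\<eta> i \<omega>)\<^sup>2) \<partial>M) = (\<integral>\<^sup>+\<omega>. liminf (\<lambda>N. ennreal ((S N \<omega>)\<^sup>2)) \<partial>M)"
    by (rule nn_integral_cong_AE)
  also have "\<dots> \<le> liminf (\<lambda>N. \<integral>\<^sup>+\<omega>. ennreal ((S N \<omega>)\<^sup>2) \<partial>M)"
    by (rule nn_integral_liminf) measurable
  also have "\<dots> \<le> limsup (\<lambda>N. \<integral>\<^sup>+\<omega>. ennreal ((S N \<omega>)\<^sup>2) \<partial>M)"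
    by (rule Liminf_le_Limsup) simp
  also have "\<dots> \<le> ennreal K" by (rule Limsup_bounded) (simp add: bound)
  finally have le: "(\<integral>\<^sup>+\<omega>. ennreal ((\<eta> i \<omega>)\<^sup>2) \<partial>M) \<le> ennreal K" .
  then show int: "integrable M (\<lambda>\<omega>. (\<eta> i \<omega>)\<^sup>2)"
    by (intro integrableI_bounded) (auto simp: le_less_trans[OF _ ennreal_less_top])
  have "ennreal (expectation (\<lambda>\<omega>. (\<eta> i \<omega>)\<^sup>2)) = (\<integral>\<^sup>+\<omega>. ennreal ((\<eta> i \<omega>)\<^sup>2) \<partial>M)"
    by (rule nn_integral_eq_integral[OF int, symmetric]) simp
  with le have "ennreal (expectation (\<lambda>\<omega>. (\<eta> i \<omega>)\<^sup>2)) \<le> ennreal K" by simp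
  moreover have "K \<ge> 0" by (simp add: K_def)
  ultimately show "expectation (\<lambda>\<omega>. (\<eta> i \<omega>)\<^sup>2) \<le> \<sigma>\<^sup>2 / (1 - \<bar>\<rho>\<bar>)\<^sup>2"
    unfolding K_def[symmetric] by (simp add: ennreal_le_iff)
qed

lemma ar1_recursion:
  assumes "stationary_ar1 M \<rho> \<epsilon> \<eta>"
  shows "AE \<omega> in M. \<eta> i \<omega> = \<rho> * \<eta> (i - 1) \<omega> + \<epsilon> i \<omega>"
proof -
  have ae: "AE \<omega> in M. (\<lambda>j. \<rho> ^ j * \<epsilon> (i - int j) \<omega>) sums \<eta> i \<omega>" for i
    using assms by (simp add: stationary_ar1_def)
  from ae[of i] ae[of "i - 1"] show ?thesis
  proof eventually_elim
    case (elim \<omega>)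
    have "(\<lambda>j. \<rho> ^ Suc j * \<epsilon> (i - int (Suc j)) \<omega>) sums (\<rho> * \<eta> (i - 1) \<omega>)"
      using sums_mult[OF elim(2), of \<rho>] by (simp add: algebra_simps)
    then have "(\<lambda>j. \<rho> ^ j * \<epsilon> (i - int j) \<omega>) sums (\<rho> * \<eta> (i - 1) \<omega> + \<rho> ^ 0 * \<epsilon> (i - int 0) \<omega>)"
      by (subst (asm) sums_Suc_iff)
    then have "(\<lambda>j. \<rho> ^ j * \<epsilon> (i - int j) \<omega>) sums (\<rho> * \<eta> (i - 1) \<omega> + \<epsilon> i \<omega>)" by simp
    with elim(1) show ?case by (rule sums_unique2)
  qed
qed

lemma (in prob_space) indep_noise_if_gaussian:
  assumes "gaussian_noise M \<sigma> \<epsilon>" "\<sigma> > 0"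
  shows "indep_noise M \<sigma> \<epsilon>"
  unfolding indep_noise_def
proof (intro conjI allI)
  have d: "distributed M lborel (\<epsilon> i) (normal_density 0 \<sigma>)" for i
    using assms by (simp add: gaussian_noise_def)
  show "indep_vars (\<lambda>_. borel) \<epsilon> UNIV" using assms by (simp add: gaussian_noise_def)
  show mean: "expectation (\<epsilon> i) = 0" for i by (rule normal_distributed_expectation[OF assms(2) d])
  show var: "variance (\<epsilon> i) = \<sigma>\<^sup>2" for i by (rule normal_distributed_variance[OF assms(2) d])
  show "integrable M (\<lambda>\<omega>. (\<epsilon> i \<omega>)\<^sup>2)" for i
  proof (rule ccontr)
    \<comment> \<open>otherwise the integral that defines the variance would take its default value 0\<close>
    assume "\<not> ?thesis"
    then show False using var[of i] mean[of i] assms(2) by (simp add: not_integrable_integral_eq)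
  qed
qed

section \<open>A uniform bound on the gains of the noise\<close>

text \<open>A bound for the gains of all pieces of the refinement by the true change-points \<open>s\<close>. A piece that is
a whole fitted segment has length at least \<open>D\<close>. Every other piece has a true change-point as an
endpoint: it is either at least \<open>L\<close> long, or it lies in one of the \<open>m' + 2\<close> windows of radius \<open>L\<close> around
the points of \<open>s\<close>, where the gain is at most the sum of the squares.\<close>

definition noise_bound :: "nat \<Rightarrow> nat \<Rightarrow> (nat \<Rightarrow> nat) \<Rightarrow> nat \<Rightarrow> nat \<Rightarrow> (nat \<Rightarrow> real) \<Rightarrow> real" where
  "noise_bound D L s m' n e = block_max D n e + block_max L n e
     + (\<Sum>j=0..m' + 1. \<Sum>i=s j + 1 - L..s j + L. (e i)\<^sup>2)"

lemma block_max_nonneg: "block_max D n e \<ge> 0"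
  by (simp add: block_max_def sum_nonneg)

lemma gain_piece_le_noise_bound:
  assumes t: "t \<in> admissible \<Delta> n m" and \<Delta>: "\<Delta> > 0" and L: "L > 0"
    and kj: "k \<le> m" "j \<le> m'"
  shows "gain e (max (t k) (s j)) (min (t (k + 1)) (s (j + 1))) \<le> noise_bound (nat \<lceil>\<Delta>\<rceil>) L s m' n e"
proof -
  let ?u = "max (t k) (s j)" and ?v = "min (t (k + 1)) (s (j + 1))" and ?D = "nat \<lceil>\<Delta>\<rceil>"
  let ?W = "\<lambda>j. \<Sum>i=s j + 1 - L..s j + L. (e i)\<^sup>2"
  have v: "?v \<le> n" using admissible_le[OF t, of "k + 1"] kj by simp
  have W: "?W j \<le> (\<Sum>j=0..m' + 1. ?W j)" if "j \<le> m' + 1" for j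
    using that by (intro member_le_sum[of j "{0..m' + 1}" ?W] sum_nonneg) auto
  have W0: "0 \<le> (\<Sum>j=0..m' + 1. ?W j)" by (intro sum_nonneg) simp
  note nonneg = block_max_nonneg[of ?D n e] block_max_nonneg[of L n e] W0
  consider (long) "L \<le> ?v - ?u" | (orig) "?u = t k" "?v = t (k + 1)"
    | (left) "?u = s j" "?v - ?u < L" | (right) "?v = s (j + 1)" "?v - ?u < L"
    by (metis linorder_not_less max_def min_def)
  then show ?thesis
  proof cases
    case long
    with gain_le_block_max[OF L long v, of e] nonneg show ?thesis by (simp add: noise_bound_def)
  next
    case orig
    have "k + 1 \<in> {1..m + 1}" using kj by simp
    with t have "real (t (k + 1)) - real (t (k + 1 - 1)) \<ge> \<Delta>" unfolding admissible_def by blast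
    then have "?D \<le> ?v - ?u" unfolding orig using \<Delta> by (simp add: nat_le_iff ceiling_le_iff)
    moreover have "0 < ?D" using \<Delta> by simp
    ultimately show ?thesis
      using gain_le_block_max[of ?D ?v ?u n e] v nonneg unfolding noise_bound_def by linarith
  next
    case left
    have "gain e ?u ?v \<le> (\<Sum>i=?u + 1..?v. (e i)\<^sup>2)" by (rule gain_le_sum_squares)
    also have "\<dots> \<le> ?W j" using left by (intro sum_mono2) auto
    finally show ?thesis using W[of j] kj nonneg unfolding noise_bound_def by linarith
  next
    case right
    have "gain e ?u ?v \<le> (\<Sum>i=?u + 1..?v. (e i)\<^sup>2)" by (rule gain_le_sum_squares)
    also have "\<dots> \<le> ?W (j + 1)" using right by (intro sum_mono2) auto
    finally show ?thesis using W[of "j + 1"] kj nonneg unfolding noise_bound_def by linarith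
  qed
qed

text \<open>With \<open>L\<close> of order \<open>\<surd>n\<close> the last two terms balance, which gives the order \<open>n / D + \<surd>n\<close>.\<close>

lemma (in prob_space) noise_bound_expectation:
  fixes \<epsilon> :: "int \<Rightarrow> 'a \<Rightarrow> real"
  assumes indep: "indep_vars (\<lambda>_. borel) \<epsilon> UNIV"
    and sq: "\<And>i. integrable M (\<lambda>\<omega>. (\<epsilon> i \<omega>)\<^sup>2)"
    and mean: "\<And>i. expectation (\<epsilon> i) = 0"
    and var: "\<And>i. expectation (\<lambda>\<omega>. (\<epsilon> i \<omega>)\<^sup>2) = \<sigma>\<^sup>2"
    and DL: "D > 0" "L > 0"
  shows "integrable M (\<lambda>\<omega>. noise_bound D L s m' n (\<lambda>i. \<epsilon> (int i) \<omega>))"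
    and "expectation (\<lambda>\<omega>. noise_bound D L s m' n (\<lambda>i. \<epsilon> (int i) \<omega>)) \<le>
      \<sigma>\<^sup>2 * (48 * (real n / real D + 1) + 48 * (real n / real L + 1) + 2 * real (m' + 2) * real L)"
proof -
  let ?e = "\<lambda>\<omega> i. \<epsilon> (int i) \<omega>"
  have shift: "\<epsilon> (int (b * D + 1 + i)) = \<epsilon> (int (b * D + 1) + int i)" for b D i
    by (simp only: of_nat_add)
  have block: "integrable M (\<lambda>\<omega>. block_max D n (?e \<omega>)) \<and>
      expectation (\<lambda>\<omega>. block_max D n (?e \<omega>)) \<le> \<sigma>\<^sup>2 * (48 * (real n / real D + 1))" if D: "D > 0" for D
  proof -
    note R = run_max_L2[OF indep sq mean var]
    have "expectation (\<lambda>\<omega>. block_max D n (?e \<omega>)) =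
        12 / real D * (\<Sum>b=0..n div D. expectation (\<lambda>\<omega>. (run_max (\<lambda>i. ?e \<omega> (b * D + 1 + i)) D)\<^sup>2))"
      unfolding block_max_def shift by (simp add: R del: of_nat_add of_nat_mult)
    also have "\<dots> \<le> 12 / real D * (\<Sum>b=0..n div D. 4 * real D * \<sigma>\<^sup>2)"
      unfolding shift by (intro mult_left_mono sum_mono R) simp
    also have "\<dots> = \<sigma>\<^sup>2 * (48 * (real (n div D) + 1))" using D by (simp add: field_simps)
    also have "\<dots> \<le> \<sigma>\<^sup>2 * (48 * (real n / real D + 1))"
      by (intro mult_left_mono add_right_mono of_nat_div_le_of_nat) simp_all
    finally show ?thesis unfolding block_max_def shift using R by (simp del: of_nat_add of_nat_mult)
  qed
  let ?W = "\<lambda>\<omega>. \<Sum>j=0..m' + 1. \<Sum>i=s j + 1 - L..s j + L. (?e \<omega> i)\<^sup>2"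
  have Wi: "integrable M ?W" using sq by simp
  have "expectation ?W = (\<Sum>j=0..m' + 1. \<Sum>i=s j + 1 - L..s j + L. \<sigma>\<^sup>2)" using sq var by simp
  also have "\<dots> = (\<Sum>j=0..m' + 1. real (card {s j + 1 - L..s j + L}) * \<sigma>\<^sup>2)" by simp
  also have "\<dots> \<le> (\<Sum>j=0..m' + 1. real (2 * L) * \<sigma>\<^sup>2)"
    by (intro sum_mono mult_right_mono) auto
  also have "\<dots> = \<sigma>\<^sup>2 * (2 * real (m' + 2) * real L)" by simp
  finally have W: "expectation ?W \<le> \<sigma>\<^sup>2 * (2 * real (m' + 2) * real L)" .
  show "integrable M (\<lambda>\<omega>. noise_bound D L s m' n (?e \<omega>))"
    unfolding noise_bound_def using block DL Wi by (intro Bochner_Integration.integrable_add) auto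
  have "expectation (\<lambda>\<omega>. noise_bound D L s m' n (?e \<omega>)) =
      expectation (\<lambda>\<omega>. block_max D n (?e \<omega>)) + expectation (\<lambda>\<omega>. block_max L n (?e \<omega>)) + expectation ?W"
    unfolding noise_bound_def using block DL Wi
    by (subst Bochner_Integration.integral_add Bochner_Integration.integrable_add; simp)+
  also have "\<dots> \<le> \<sigma>\<^sup>2 * (48 * (real n / real D + 1)) + \<sigma>\<^sup>2 * (48 * (real n / real L + 1))
      + \<sigma>\<^sup>2 * (2 * real (m' + 2) * real L)"
    using block[OF DL(1)] block[OF DL(2)] W by linarith
  finally show "expectation (\<lambda>\<omega>. noise_bound D L s m' n (?e \<omega>)) \<le>
      \<sigma>\<^sup>2 * (48 * (real n / real D + 1) + 48 * (real n / real L + 1) + 2 * real (m' + 2) * real L)"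
    by (simp only: distrib_left)
qed

section \<open>Comparison of the penalised criteria\<close>

text \<open>With \<open>m > m'\<close> change-points the gains, at most \<open>G\<close> on each of the \<open>(m + 1) (m' + 1)\<close> pieces, do not pay for a
single penalty term \<open>b\<close>; with \<open>m < m'\<close> the cost of a missed change-point exceeds all the penalty terms.\<close>

lemma true_order_minimises_criterion:
  fixes \<alpha> e :: "nat \<Rightarrow> real"
  assumes s: "s 0 = 0" "s (m' + 1) = n" "s \<in> admissible D n m'"
    and gap: "\<And>j. j \<le> m' \<Longrightarrow> s j + 2 * w \<le> s (Suc j)" and w: "w > 0"
    and x: "\<And>j i. j \<le> m' \<Longrightarrow> s j < i \<Longrightarrow> i \<le> s (j + 1) \<Longrightarrow> x i - \<rho> * x (i - 1) = \<alpha> j + e i"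
    and G: "\<And>m t k j. t \<in> admissible D n m \<Longrightarrow> k \<le> m \<Longrightarrow> j \<le> m' \<Longrightarrow>
      gain e (max (t k) (s j)) (min (t (k + 1)) (s (j + 1))) \<le> G"
    and h: "\<And>j. 1 \<le> j \<Longrightarrow> j \<le> m' \<Longrightarrow> h \<le> (\<alpha> j - \<alpha> (j - 1))\<^sup>2"
    and mm: "m \<noteq> m'" "m \<le> mmax" "m' \<le> mmax" "admissible D n m \<noteq> {}"
    and over: "2 * (real mmax + 1)\<^sup>2 * G < real n * b" and G0: "G \<ge> 0"
    and under: "real n * b * (real m' + 1) \<le> real w * h / 4"
    and b: "b \<ge> 0"
  shows "SS D n m' x \<rho> / real n + b * real m' < SS D n m x \<rho> / real n + b * real m"
proof -
  have mono: "\<And>j. j \<le> m' \<Longrightarrow> s j \<le> s (Suc j)" using gap by (meson add_leD1)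
  have n: "n > 0" using gap[of m'] w s(2) by simp
  let ?E = "\<Sum>i=1..n. (e i)\<^sup>2"
  from s(3) have "admissible D n m' \<noteq> {}" by blast
  then have SSle: "SS D n m' x \<rho> \<le> residual_ss m' x \<rho> \<alpha> s"
    using SS_attained[of D n m' x \<rho>] s(3) by fastforce
  also have "\<dots> = ?E" by (rule residual_ss_true) (use mono s x in blast)+
  finally have upper: "SS D n m' x \<rho> \<le> ?E" .
  obtain \<delta> t where t: "t \<in> admissible D n m" "SS D n m x \<rho> = residual_ss m x \<rho> \<delta> t"
    using SS_attained[OF mm(4), of x \<rho>] by blast
  define J where "J = (\<Sum>k=0..m. \<Sum>j=0..m'. real (min (t (k + 1)) (s (j + 1)) - max (t k) (s j)) * (\<alpha> j - \<delta> k)\<^sup>2)"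
  have "real ((m + 1) * (m' + 1)) \<le> (real mmax + 1)\<^sup>2"
    using mm unfolding power2_eq_square of_nat_mult by (intro mult_mono) auto
  then have "2 * real ((m + 1) * (m' + 1)) * G \<le> 2 * (real mmax + 1)\<^sup>2 * G"
    using G0 by (intro mult_right_mono) auto
  moreover have "?E + J / 2 - 2 * real ((m + 1) * (m' + 1)) * G \<le> SS D n m x \<rho>"
    unfolding t(2) J_def by (rule residual_ss_ge[OF t(1)]) (use mono s x G[OF t(1)] in blast)+
  ultimately have lower: "?E + J / 2 - real n * b < SS D n m x \<rho>" using over by linarith
  have "SS D n m' x \<rho> + real n * b * real m' < SS D n m x \<rho> + real n * b * real m"
  proof (cases "m < m'")
    case True
    have "real w * h / 2 \<le> J"
      unfolding J_def by (rule missed_change_point_cost[OF t(1) True s(1,2)]) (use gap w h in blast)+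
    then have "real n * b * real m' + real n * b \<le> J / 2" using under by (simp add: algebra_simps)
    moreover have "0 \<le> real n * b * real m" using b by simp
    ultimately show ?thesis using upper lower by linarith
  next
    case False
    have "0 \<le> J" unfolding J_def by (intro sum_nonneg mult_nonneg_nonneg) auto
    moreover have "real m' + 1 \<le> real m" using False mm by linarith
    then have "real n * b * (real m' + 1) \<le> real n * b * real m" using b by (intro mult_left_mono) auto
    then have "real n * b * real m' + real n * b \<le> real n * b * real m" by (simp add: algebra_simps)
    ultimately show ?thesis using upper lower by linarith
  qed
  then have "(SS D n m' x \<rho> + real n * b * real m') / real n < (SS D n m x \<rho> + real n * b * real m) / real n"
    using n by (intro divide_strict_right_mono) auto
  then show ?thesis using n by (simp add: add_divide_distrib)
qed

text \<open>Quasi-differencing with an estimated coefficient \<open>r\<close> returns the innovations up to two errors: the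
estimation error times the lagged noise, and one boundary term just after each change-point, where
the lagged observation still has the previous level. On the first segment there is no boundary term,
and indeed \<open>\<mu> j - \<mu> (j - 1)\<close> vanishes for \<open>j = 0\<close> by the truncated subtraction.\<close>

lemma quasi_differenced_model:
  fixes \<mu> y :: "nat \<Rightarrow> real" and \<eta> \<epsilon> :: "int \<Rightarrow> real"
  assumes s: "\<And>j. j \<le> m' \<Longrightarrow> s j < s (Suc j)" "s 0 = 0" and j: "j \<le> m'" and i: "s j < i" "i \<le> s (j + 1)"
    and y0: "y 0 = \<mu> 0 + \<eta> 0"
    and y: "\<And>j i. j \<le> m' \<Longrightarrow> s j < i \<Longrightarrow> i \<le> s (j + 1) \<Longrightarrow> y i = \<mu> j + \<eta> (int i)"
    and ar: "\<eta> (int i) = \<rho> * \<eta> (int i - 1) + \<epsilon> (int i)"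
  shows "y i - r * y (i - 1) = (1 - r) * \<mu> j + (\<epsilon> (int i) +
    ((\<rho> - r) * \<eta> (int i - 1) + (if i = s j + 1 then r * (\<mu> j - \<mu> (j - 1)) else 0)))"
proof -
  have i1: "int i - 1 = int (i - 1)" using i by linarith
  have "y (i - 1) = (if i = s j + 1 then \<mu> (j - 1) else \<mu> j) + \<eta> (int (i - 1))"
  proof (cases "i = s j + 1")
    case True
    show ?thesis
    proof (cases j)
      case 0
      with True s y0 show ?thesis by simp
    next
      case (Suc l)
      with True s(1)[of l] j y[of l "i - 1"] show ?thesis by simp
    qed
  next
    case False
    then have "y (i - 1) = \<mu> j + \<eta> (int (i - 1))" using i j by (intro y) auto
    with False show ?thesis by simp
  qed
  then show ?thesis unfolding y[OF j i] ar i1 by (auto simp: algebra_simps)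
qed

lemma sum_perturbation_squares_le:
  fixes \<eta> :: "int \<Rightarrow> real"
  assumes "v \<le> n"
  shows "(\<Sum>i=u + 1..v. (a * \<eta> (int i - 1) + (if i = p then c else 0))\<^sup>2)
     \<le> 2 * a\<^sup>2 * (\<Sum>i<n. (\<eta> (int i))\<^sup>2) + 2 * c\<^sup>2"
proof -
  have "(\<Sum>i=u + 1..v. (a * \<eta> (int i - 1) + (if i = p then c else 0))\<^sup>2)
     \<le> (\<Sum>i=u + 1..v. 2 * a\<^sup>2 * (\<eta> (int i - 1))\<^sup>2 + (if i = p then 2 * c\<^sup>2 else 0))"
  proof (rule sum_mono)
    fix i
    have "(x + z)\<^sup>2 \<le> 2 * x\<^sup>2 + 2 * z\<^sup>2" for x z :: real
      using zero_le_power2[of "x - z"] by (simp add: power2_eq_square algebra_simps)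
    from this[of "a * \<eta> (int i - 1)" c]
    show "(a * \<eta> (int i - 1) + (if i = p then c else 0))\<^sup>2
      \<le> 2 * a\<^sup>2 * (\<eta> (int i - 1))\<^sup>2 + (if i = p then 2 * c\<^sup>2 else 0)"
      by (auto simp: power_mult_distrib mult.assoc)
  qed
  also have "\<dots> = 2 * a\<^sup>2 * (\<Sum>i=u + 1..v. (\<eta> (int i - 1))\<^sup>2) + (if p \<in> {u + 1..v} then 2 * c\<^sup>2 else 0)"
    by (simp add: sum.distrib sum_distrib_left)
  also have "(\<Sum>i=u + 1..v. (\<eta> (int i - 1))\<^sup>2) = (\<Sum>i=u..<v. (\<eta> (int i))\<^sup>2)"
    by (rule sum.reindex_bij_witness[of _ Suc "\<lambda>i. i - 1"]) auto
  also have "2 * a\<^sup>2 * (\<Sum>i=u..<v. (\<eta> (int i))\<^sup>2) \<le> 2 * a\<^sup>2 * (\<Sum>i<n. (\<eta> (int i))\<^sup>2)"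
    using assms by (intro mult_left_mono sum_mono2) auto
  finally have "(\<Sum>i=u + 1..v. (a * \<eta> (int i - 1) + (if i = p then c else 0))\<^sup>2)
     \<le> 2 * a\<^sup>2 * (\<Sum>i<n. (\<eta> (int i))\<^sup>2) + (if p \<in> {u + 1..v} then 2 * c\<^sup>2 else 0)"
    by simp
  moreover have "(if p \<in> {u + 1..v} then 2 * c\<^sup>2 else 0) \<le> 2 * c\<^sup>2" by simp
  ultimately show ?thesis by linarith
qed

text \<open>The deterministic core of the consistency theorem. The perturbation of the innovations has a bounded
square norm, hence it changes each gain by a bounded amount: \<open>c\<close> will be of order \<open>1 / n\<close>, and the
boundary terms are at most \<open>4 \<Sum> (\<mu> j - \<mu> (j - 1))\<^sup>2\<close> because \<open>\<bar>r\<bar> \<le> 2\<close>. As \<open>r\<close> is closer to \<open>\<rho>\<close> than to \<open>1\<close>, the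
levels \<open>(1 - r) \<mu> j\<close> of the differenced signal keep a fixed fraction of their jumps.\<close>

lemma true_order_minimises_penalised_SS:
  fixes \<mu> y :: "nat \<Rightarrow> real" and \<eta> \<epsilon> :: "int \<Rightarrow> real"
  assumes s: "s 0 = 0" "s (m' + 1) = n" "s \<in> admissible D n m'"
    and gap: "\<And>j. j \<le> m' \<Longrightarrow> s j + 2 * w \<le> s (Suc j)" and w: "w > 0" and D: "D > 0" and L: "L > 0"
    and y0: "y 0 = \<mu> 0 + \<eta> 0"
    and y: "\<And>j i. j \<le> m' \<Longrightarrow> s j < i \<Longrightarrow> i \<le> s (j + 1) \<Longrightarrow> y i = \<mu> j + \<eta> (int i)"
    and ar: "\<And>i. 1 \<le> i \<Longrightarrow> i \<le> n \<Longrightarrow> \<eta> (int i) = \<rho> * \<eta> (int i - 1) + \<epsilon> (int i)"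
    and \<rho>: "\<bar>\<rho>\<bar> < 1" and r: "\<bar>r - \<rho>\<bar> \<le> (1 - \<rho>) / 2" "(r - \<rho>)\<^sup>2 \<le> c"
    and h: "\<And>j. 1 \<le> j \<Longrightarrow> j \<le> m' \<Longrightarrow> h \<le> (\<mu> j - \<mu> (j - 1))\<^sup>2" and h0: "h \<ge> 0"
    and mm: "m \<noteq> m'" "m \<le> mmax" "m' \<le> mmax" "admissible D n m \<noteq> {}"
    and over: "2 * (real mmax + 1)\<^sup>2 * (2 * noise_bound (nat \<lceil>D\<rceil>) L s m' n (\<lambda>i. \<epsilon> (int i))
      + 2 * (2 * c * (\<Sum>i<n. (\<eta> (int i))\<^sup>2) + 8 * (\<Sum>j=1..m'. (\<mu> j - \<mu> (j - 1))\<^sup>2))) < real n * b"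
      (is "_ * ?G < _")
    and under: "real n * b * (real m' + 1) \<le> real w * (((1 - \<rho>) / 2)\<^sup>2 * h) / 4"
    and b: "b \<ge> 0"
  shows "SS D n m' y r / real n + b * real m' < SS D n m y r / real n + b * real m"
proof -
  define \<alpha> where "\<alpha> j = (1 - r) * \<mu> j" for j
  \<comment> \<open>\<open>y i - \<eta> i\<close> is the true level at \<open>i\<close>, so \<open>d\<close> needs no name for the segment that contains \<open>i\<close>\<close>
  define d where "d i = y i - r * y (i - 1) - (1 - r) * (y i - \<eta> (int i)) - \<epsilon> (int i)" for i
  have mono: "s i \<le> s j" if "i \<le> j" "j \<le> m' + 1" for i j
    using that
  proof (induction j)
    case (Suc j)
    then show ?case using gap[of j] by (cases "i = Suc j") auto
  qed simp
  have smono: "s j < s (Suc j)" if "j \<le> m'" for j using gap[OF that] w by simp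
  have d: "d i = (\<rho> - r) * \<eta> (int i - 1) + (if i = s j + 1 then r * (\<mu> j - \<mu> (j - 1)) else 0)"
    if j: "j \<le> m'" and i: "s j < i" "i \<le> s (j + 1)" for j i
  proof -
    have "1 \<le> i" "i \<le> n" using i mono[of "j + 1" "m' + 1"] j s(2) by auto
    then have "y i - r * y (i - 1) = (1 - r) * \<mu> j + (\<epsilon> (int i) +
        ((\<rho> - r) * \<eta> (int i - 1) + (if i = s j + 1 then r * (\<mu> j - \<mu> (j - 1)) else 0)))"
      by (intro quasi_differenced_model[where s = s and m' = m'] smono s(1) j i y0 y ar)
    then show ?thesis using y[OF j i] by (simp add: d_def algebra_simps)
  qed
  have x: "y i - r * y (i - 1) = \<alpha> j + (\<epsilon> (int i) + d i)"
    if "j \<le> m'" "s j < i" "i \<le> s (j + 1)" for j i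
    using y[OF that] by (simp add: \<alpha>_def d_def algebra_simps)
  have "- 1 < \<rho>" using \<rho> by auto
  then have r2: "\<bar>r\<bar> \<le> 2" using r(1) \<rho> abs_triangle_ineq[of "r - \<rho>" \<rho>] by auto
  let ?J = "\<Sum>j=1..m'. (\<mu> j - \<mu> (j - 1))\<^sup>2"
  have jump: "(r * (\<mu> j - \<mu> (j - 1)))\<^sup>2 \<le> 4 * ?J" if "j \<le> m'" for j
  proof -
    have "(\<mu> j - \<mu> (j - 1))\<^sup>2 \<le> ?J"
    proof (cases "j = 0")
      case False
      then show ?thesis
        using that by (intro member_le_sum[of j "{1..m'}" "\<lambda>j. (\<mu> j - \<mu> (j - 1))\<^sup>2"]) auto
    qed (simp add: sum_nonneg)
    moreover have "r\<^sup>2 \<le> 4" using r2 abs_le_square_iff[of r 2] by simp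
    ultimately show ?thesis unfolding power_mult_distrib by (intro mult_mono) auto
  qed
  have G: "gain (\<lambda>i. \<epsilon> (int i) + d i) (max (t k) (s j)) (min (t (k + 1)) (s (j + 1))) \<le> ?G"
    if t: "t \<in> admissible D n m" and k: "k \<le> m" and j: "j \<le> m'" for m t k j
  proof -
    let ?u = "max (t k) (s j)" and ?v = "min (t (k + 1)) (s (j + 1))"
    have v: "?v \<le> n" using admissible_le[OF t, of "k + 1"] k by simp
    have "gain d ?u ?v \<le> (\<Sum>i=?u + 1..?v. (d i)\<^sup>2)" by (rule gain_le_sum_squares)
    also have "\<dots> = (\<Sum>i=?u + 1..?v. ((\<rho> - r) * \<eta> (int i - 1)
        + (if i = s j + 1 then r * (\<mu> j - \<mu> (j - 1)) else 0))\<^sup>2)"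
      using d[OF j] by (intro sum.cong refl arg_cong[where f = "\<lambda>x. x\<^sup>2"]) auto
    also have "\<dots> \<le> 2 * (\<rho> - r)\<^sup>2 * (\<Sum>i<n. (\<eta> (int i))\<^sup>2) + 2 * (r * (\<mu> j - \<mu> (j - 1)))\<^sup>2"
      by (rule sum_perturbation_squares_le[OF v])
    also have "\<dots> \<le> 2 * c * (\<Sum>i<n. (\<eta> (int i))\<^sup>2) + 2 * (4 * ?J)"
      using r(2) jump[OF j]
      by (intro add_mono mult_right_mono mult_left_mono sum_nonneg) (auto simp: power2_commute)
    finally have "gain d ?u ?v \<le> 2 * c * (\<Sum>i<n. (\<eta> (int i))\<^sup>2) + 8 * ?J" by simp
    moreover have "gain (\<lambda>i. \<epsilon> (int i)) ?u ?v \<le> noise_bound (nat \<lceil>D\<rceil>) L s m' n (\<lambda>i. \<epsilon> (int i))"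
      by (rule gain_piece_le_noise_bound[OF t D L k j])
    ultimately have "2 * gain (\<lambda>i. \<epsilon> (int i)) ?u ?v + 2 * gain d ?u ?v \<le> ?G"
      by (intro add_mono mult_left_mono) simp_all
    then show ?thesis by (rule order_trans[OF gain_add_le])
  qed
  have c: "c \<ge> 0" using r(2) zero_le_power2[of "r - \<rho>"] by linarith
  have h': "((1 - \<rho>) / 2)\<^sup>2 * h \<le> (\<alpha> j - \<alpha> (j - 1))\<^sup>2" if "1 \<le> j" "j \<le> m'" for j
  proof -
    have "((1 - \<rho>) / 2)\<^sup>2 \<le> (1 - r)\<^sup>2"
      using r(1) \<rho> by (intro power_mono) (simp_all add: abs_if split: if_splits)
    then have "((1 - \<rho>) / 2)\<^sup>2 * h \<le> (1 - r)\<^sup>2 * (\<mu> j - \<mu> (j - 1))\<^sup>2"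
      using h[OF that] h0 by (intro mult_mono) auto
    then show ?thesis by (simp add: \<alpha>_def power_mult_distrib flip: right_diff_distrib)
  qed
  have G0: "?G \<ge> 0"
    using c by (auto simp: noise_bound_def intro!: add_nonneg_nonneg mult_nonneg_nonneg sum_nonneg block_max_nonneg)
  show ?thesis
    by (rule true_order_minimises_criterion[where \<alpha> = \<alpha>, OF s gap w x G h' mm over G0 under b])
qed

text \<open>Segments of equal length \<open>q\<close>, the last of which absorbs the remainder.\<close>

lemma admissible_nonempty:
  assumes q: "q > 0" "D \<le> real q" "(m + 1) * q \<le> n"
  shows "admissible D n m \<noteq> {}"
proof -
  define t where "t k = (if k = m + 1 then n else k * q)" for k
  have "t (k - 1) < t k \<and> real (t k) - real (t (k - 1)) \<ge> D" if k: "k \<in> {1..m + 1}" for k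
  proof -
    obtain l where l: "k = Suc l" "l \<le> m" using k by (cases k) (auto simp: less_Suc_eq_le)
    have "t l = l * q" using l by (simp add: t_def)
    moreover have "l * q + q \<le> t (Suc l)"
    proof (cases "l = m")
      case True
      then show ?thesis using q(3) by (simp add: t_def)
    qed (simp add: t_def)
    ultimately have "t l + q \<le> t (Suc l)" by simp
    then have "t l < t (Suc l)" "real (t l) + real q \<le> real (t (Suc l))"
      using q(1) by (linarith, metis of_nat_add of_nat_le_iff)
    with l q(2) show ?thesis by simp
  qed
  then have "t \<in> admissible D n m" by (simp add: admissible_def t_def)
  then show ?thesis by blast
qed

lemma cp_time_gap:
  assumes "0 \<le> \<tau> k" "g \<le> \<tau> (Suc k) - \<tau> k" "g \<ge> 0"
  shows "real (cp_time \<tau> n k) + real n * g - 1 \<le> real (cp_time \<tau> n (Suc k))"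
proof -
  have "real n * (\<tau> k + g) \<le> real n * \<tau> (Suc k)" using assms by (intro mult_left_mono) auto
  moreover have "0 \<le> real n * \<tau> k" "0 \<le> real n * \<tau> (Suc k)" using assms by auto
  ultimately show ?thesis
    unfolding cp_time_def distrib_left by (simp add: of_nat_nat) linarith
qed

section \<open>Consistency of the selected number of change-points\<close>

theorem proposition5:
  fixes M :: "'a measure"
    and mstar mmax :: nat
    and \<tau> \<mu> :: "nat \<Rightarrow> real"
    and \<rho> \<sigma> :: real
    and \<epsilon> \<eta> :: "int \<Rightarrow> 'a \<Rightarrow> real"
    and y :: "nat \<Rightarrow> nat \<Rightarrow> 'a \<Rightarrow> real"
    and \<rho>bar :: "nat \<Rightarrow> 'a \<Rightarrow> real"
    and \<Delta> \<beta> :: "nat \<Rightarrow> real"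
    and mhat :: "nat \<Rightarrow> 'a \<Rightarrow> nat"
  assumes "prob_space M"
    and "\<tau> 0 = 0" and "\<tau> (mstar + 1) = 1"
    and "\<forall>k\<in>{0..mstar}. \<tau> k < \<tau> (k + 1)"
    and "\<forall>k\<in>{1..mstar}. \<mu> k \<noteq> \<mu> (k - 1)"
    and "\<bar>\<rho>\<bar> < 1" and "\<sigma> > 0"
    and "gaussian_noise M \<sigma> \<epsilon> \<or> indep_noise M \<sigma> \<epsilon>"
    and "stationary_ar1 M \<rho> \<epsilon> \<eta>"
    and "\<forall>n\<ge>1. change_point_model M mstar \<tau> \<mu> \<eta> n (y n)"
    and "\<forall>n\<ge>1. \<rho>bar n \<in> borel_measurable M"
    and "bounded_in_prob M (\<lambda>n \<omega>. \<rho>bar n \<omega> - \<rho>) (\<lambda>n. real n powr (- (1 / 2)))"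
    and "(\<lambda>n. \<Delta> n / real n) \<longlonglongrightarrow> 0"
    and "\<exists>\<alpha>>0. filterlim (\<lambda>n. real n powr (- \<alpha>) * \<Delta> n) at_top sequentially"
    and "mmax \<ge> mstar"
    and "\<forall>n\<ge>1. \<beta> n > 0"
    and "\<beta> \<longlonglongrightarrow> 0"
    and "filterlim (\<lambda>n. real n powr (1 / 2) * \<beta> n) at_top sequentially"
    and "filterlim (\<lambda>n. \<Delta> n * \<beta> n) at_top sequentially"
    and "\<forall>n\<ge>1. mhat n \<in> measurable M (count_space UNIV)"
    and "\<forall>n\<ge>1. (\<forall>m\<le>mmax. admissible (\<Delta> n) n m \<noteq> {}) \<longrightarrow>
           (\<forall>\<omega>\<in>space M. is_arg_min
              (\<lambda>m. SS (\<Delta> n) n m (\<lambda>i. y n i \<omega>) (\<rho>bar n \<omega>) / real n + \<beta> n * real m)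
              (\<lambda>m. m \<le> mmax) (mhat n \<omega>))"
  shows "converges_in_prob M (\<lambda>n \<omega>. real (mhat n \<omega>)) (real mstar)"
proof -
  interpret prob_space M by fact
  define \<kappa> K J where "\<kappa> = 1 / (2 * (real mmax + 1)\<^sup>2)" and "K = \<sigma>\<^sup>2 / (1 - \<bar>\<rho>\<bar>)\<^sup>2"
    and "J = (\<Sum>j=1..mstar. (\<mu> j - \<mu> (j - 1))\<^sup>2)"
  have \<kappa>: "\<kappa> > 0" by (simp add: \<kappa>_def)
  have \<rho>: "\<bar>\<rho>\<bar> < 1" by fact
  have "indep_noise M \<sigma> \<epsilon>" using assms(7,8) indep_noise_if_gaussian by blast
  then have indep: "indep_vars (\<lambda>_. borel) \<epsilon> UNIV"
    and sq: "\<And>i. integrable M (\<lambda>\<omega>. (\<epsilon> i \<omega>)\<^sup>2)" and mean: "\<And>i. expectation (\<epsilon> i) = 0"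
    and "\<And>i. variance (\<epsilon> i) = \<sigma>\<^sup>2"
    unfolding indep_noise_def by blast+
  then have var: "\<And>i. expectation (\<lambda>\<omega>. (\<epsilon> i \<omega>)\<^sup>2) = \<sigma>\<^sup>2" by simp
  have [measurable]: "\<epsilon> i \<in> borel_measurable M" for i using indep by (simp add: indep_vars_def)
  have [measurable]: "\<eta> i \<in> borel_measurable M" for i using assms(9) by (simp add: stationary_ar1_def)
  note \<eta>2 = ar1_second_moment[OF assms(9) \<rho> _ sq var]

  have mono: "\<tau> i \<le> \<tau> j" if "i \<le> j" "j \<le> mstar + 1" for i j
    using that
  proof (induction j)
    case (Suc j)
    then show ?case using assms(4)[rule_format, of j] by (cases "i = Suc j") auto
  qed simp
  have \<tau>0: "\<tau> k \<ge> 0" if "k \<le> mstar + 1" for k using mono[of 0 k] that assms(2) by simp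
  obtain g where g: "g > 0" "\<And>k. k \<le> mstar \<Longrightarrow> g \<le> \<tau> (Suc k) - \<tau> k"
  proof
    let ?A = "(\<lambda>k. \<tau> (Suc k) - \<tau> k) ` {0..mstar}"
    show "Min ?A > 0" using assms(4) by (subst Min_gr_iff) auto
    show "Min ?A \<le> \<tau> (Suc k) - \<tau> k" if "k \<le> mstar" for k using that by (intro Min_le) auto
  qed
  obtain h where h: "h > 0" "\<And>j. 1 \<le> j \<Longrightarrow> j \<le> mstar \<Longrightarrow> h \<le> (\<mu> j - \<mu> (j - 1))\<^sup>2"
  proof
    let ?A = "insert 1 ((\<lambda>j. (\<mu> j - \<mu> (j - 1))\<^sup>2) ` {1..mstar})"
    show "Min ?A > 0" using assms(5) by (subst Min_gr_iff) auto
    show "Min ?A \<le> (\<mu> j - \<mu> (j - 1))\<^sup>2" if "1 \<le> j" "j \<le> mstar" for j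
      using that by (intro Min_le) auto
  qed

  define s where "s n = cp_time \<tau> n" for n
  have s0: "s n 0 = 0" "s n (mstar + 1) = n" for n using assms(2,3) by (simp_all add: s_def cp_time_def)
  have s_gap: "real (s n k) + real n * g - 1 \<le> real (s n (Suc k))" if "k \<le> mstar" for n k
    unfolding s_def using that g \<tau>0 by (intro cp_time_gap) auto
  define D L where "D n = nat \<lceil>\<Delta> n\<rceil>" and "L n = nat \<lceil>sqrt (real n)\<rceil>" for n
  define Q where "Q C n \<omega> = 2 * noise_bound (D n) (L n) (s n) mstar n (\<lambda>i. \<epsilon> (int i) \<omega>)
      + 2 * (2 * (C\<^sup>2 / real n) * (\<Sum>i<n. (\<eta> (int i) \<omega>)\<^sup>2) + 8 * J)" for C n \<omega>

  \<comment> \<open>the minimal segment length diverges, as its product with the null sequence \<open>\<beta>\<close> does\<close>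
  have \<Delta>1: "\<forall>\<^sub>F n in sequentially. \<Delta> n \<ge> 1"
  proof -
    have "\<forall>\<^sub>F n in sequentially. \<Delta> n * \<beta> n \<ge> 1" using assms(19) by (simp add: filterlim_at_top)
    moreover have "\<forall>\<^sub>F n in sequentially. \<beta> n < 1" using assms(17) by (rule order_tendstoD) simp
    ultimately show ?thesis using eventually_ge_at_top[of 1]
    proof eventually_elim
      case (elim n)
      have "\<beta> n > 0" using assms(16) elim by auto
      show ?case
      proof (rule ccontr)
        assume "\<not> 1 \<le> \<Delta> n"
        then have "\<Delta> n * \<beta> n < 1 * \<beta> n" using \<open>\<beta> n > 0\<close> by (intro mult_strict_right_mono) auto
        with elim show False by simp
      qed
    qed
  qed

  \<comment> \<open>\<open>\<kappa>\<close> halves the reciprocal of the bound \<open>(mmax + 1)\<^sup>2\<close> on the number of pieces, so \<open>Q < \<kappa> n \<beta>\<close> excludes overfitting\<close>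
  have good: "\<forall>\<^sub>F n in sequentially. \<forall>\<omega>\<in>space M. \<bar>\<rho>bar n \<omega> - \<rho>\<bar> \<le> C * real n powr (- (1 / 2)) \<longrightarrow>
      Q C n \<omega> < \<kappa> * (real n * \<beta> n) \<longrightarrow>
      (\<forall>i\<in>{1..n}. \<eta> (int i) \<omega> = \<rho> * \<eta> (int i - 1) \<omega> + \<epsilon> (int i) \<omega>) \<longrightarrow> mhat n \<omega> = mstar" for C
  proof -
    have "(\<lambda>n. C * real n powr (- (1 / 2))) \<longlonglongrightarrow> 0" by real_asymp
    then have e1: "\<forall>\<^sub>F n in sequentially. C * real n powr (- (1 / 2)) < (1 - \<rho>) / 2"
      using \<rho> by (intro order_tendstoD) auto
    have e2: "\<forall>\<^sub>F n in sequentially. \<Delta> n / real n < min (g / 2) (1 / (2 * (real mmax + 1)))"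
      using g by (intro order_tendstoD[OF assms(13)]) auto
    have e3: "\<forall>\<^sub>F n in sequentially. real n > max (8 / g) (2 * (real mmax + 1))"
      using filterlim_real_sequentially unfolding filterlim_at_top_dense by blast
    \<comment> \<open>below \<open>b0\<close> the penalties cost less than a missed change-point, whose window has radius \<open>w \<ge> n g / 8\<close>\<close>
    define b0 where "b0 = g * (((1 - \<rho>) / 2)\<^sup>2 * h) / 32 / (real mstar + 1)"
    have "b0 > 0" using g h \<rho> by (simp add: b0_def)
    then have e4: "\<forall>\<^sub>F n in sequentially. \<beta> n < b0" by (rule order_tendstoD[OF assms(17)])
    show ?thesis
      using e1 e2 e3 e4 \<Delta>1 eventually_ge_at_top[of 1]
    proof eventually_elim
      case (elim n)
      have n: "real n > 0" "n \<ge> 1" using elim by auto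
      have \<Delta>n: "\<Delta> n < real n * (g / 2)" "\<Delta> n < real n / (2 * (real mmax + 1))"
        using elim(2) n by (simp_all add: field_simps)
      have ng: "real n * g > 8" using elim(3) g by (simp add: field_simps)
      \<comment> \<open>a quarter of the smallest true gap: windows of this radius are disjoint despite the rounding\<close>
      define w where "w = nat \<lfloor>real n * g / 4\<rfloor>"
      have w: "real w \<le> real n * g / 4" "real w > real n * g / 4 - 1"
        using ng unfolding w_def by (simp_all add: of_nat_nat) linarith
      have "real w > 0" using w ng by linarith
      then have w0: "w > 0" by simp
      have gap: "s n j + 2 * w \<le> s n (Suc j)" if "j \<le> mstar" for j
      proof -
        have "real (s n j + 2 * w) \<le> real (s n (Suc j))" using s_gap[OF that, of n] w ng by simp
        then show ?thesis by (simp only: of_nat_le_iff)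
      qed
      have adm: "s n \<in> admissible (\<Delta> n) n mstar"
        unfolding admissible_def
      proof (intro CollectI conjI s0 ballI)
        fix k assume "k \<in> {1..mstar + 1}"
        then obtain l where l: "k = Suc l" "l \<le> mstar" by (cases k) auto
        show "s n (k - 1) < s n k" using gap[OF l(2)] w0 l by simp
        show "\<Delta> n \<le> real (s n k) - real (s n (k - 1))" using s_gap[OF l(2), of n] \<Delta>n(1) ng l by simp
      qed
      have nonempty: "admissible (\<Delta> n) n m \<noteq> {}" if m: "m \<le> mmax" for m
      proof -
        let ?q = "n div (mmax + 1)"
        have "n < (?q + 1) * (mmax + 1)" using dividend_less_div_times[of "mmax + 1" n] by simp
        then have "real n < real ((?q + 1) * (mmax + 1))" by (simp only: of_nat_less_iff)
        then have "real n < (real ?q + 1) * (real mmax + 1)" by (simp only: of_nat_mult of_nat_add of_nat_1)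
        then have "real n / (real mmax + 1) < real ?q + 1" by (subst pos_divide_less_eq) auto
        then have "real n / (real mmax + 1) - 1 < real ?q" by linarith
        moreover define p where "p = real n / (2 * (real mmax + 1))"
        have "1 \<le> p" unfolding p_def using elim(3) by (simp add: pos_le_divide_eq)
        moreover have "a / c = 2 * (a / (2 * c))" for a c :: real by simp
        then have "real n / (real mmax + 1) = 2 * p" unfolding p_def .
        ultimately have q: "\<Delta> n \<le> real ?q" using \<Delta>n(2)[folded p_def] by linarith
        then have "?q > 0" using elim(5) by (cases "?q = 0") auto
        moreover have "(m + 1) * ?q \<le> n"
          using m mult_le_mono1[of "m + 1" "mmax + 1" ?q] times_div_less_eq_dividend[of "mmax + 1" n]
          by linarith
        ultimately show ?thesis using q by (intro admissible_nonempty) auto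
      qed
      have \<beta>n: "\<beta> n > 0" using assms(16) n by auto
      have under: "real n * \<beta> n * (real mstar + 1) \<le> real w * (((1 - \<rho>) / 2)\<^sup>2 * h) / 4"
      proof -
        have "\<beta> n * (real mstar + 1) \<le> b0 * (real mstar + 1)" using elim(4) by (intro mult_right_mono) auto
        also have "\<dots> = g * (((1 - \<rho>) / 2)\<^sup>2 * h) / 32"
          unfolding b0_def by (rule trans[OF times_divide_eq_left nonzero_mult_div_cancel_right]) simp
        finally have "real n * (\<beta> n * (real mstar + 1)) \<le> real n * (g * (((1 - \<rho>) / 2)\<^sup>2 * h) / 32)"
          by (rule mult_left_mono) simp
        also have "\<dots> = (real n * g / 8) * (((1 - \<rho>) / 2)\<^sup>2 * h) / 4" by simp
        also have "\<dots> \<le> real w * (((1 - \<rho>) / 2)\<^sup>2 * h) / 4"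
          using w ng h(1) by (intro divide_right_mono mult_right_mono) auto
        finally show ?thesis by (simp only: mult.assoc)
      qed
      show ?case
      proof (intro ballI impI)
        fix \<omega> assume \<omega>: "\<omega> \<in> space M" and r: "\<bar>\<rho>bar n \<omega> - \<rho>\<bar> \<le> C * real n powr (- (1 / 2))"
          and QQ: "Q C n \<omega> < \<kappa> * (real n * \<beta> n)"
          and ar: "\<forall>i\<in>{1..n}. \<eta> (int i) \<omega> = \<rho> * \<eta> (int i - 1) \<omega> + \<epsilon> (int i) \<omega>"
        let ?r = "\<rho>bar n \<omega>"
        let ?crit = "\<lambda>m. SS (\<Delta> n) n m (\<lambda>i. y n i \<omega>) ?r / real n + \<beta> n * real m"
        have mhat: "is_arg_min ?crit (\<lambda>m. m \<le> mmax) (mhat n \<omega>)"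
          using assms(21) n nonempty \<omega> by blast
        have "change_point_model M mstar \<tau> \<mu> \<eta> n (y n)" using assms(10) n by blast
        then have y: "y n 0 \<omega> = \<mu> 0 + \<eta> 0 \<omega>"
          "\<And>j i. j \<le> mstar \<Longrightarrow> s n j < i \<Longrightarrow> i \<le> s n (j + 1) \<Longrightarrow> y n i \<omega> = \<mu> j + \<eta> (int i) \<omega>"
          using \<omega> unfolding change_point_model_def s_def by auto
        have "real n powr (- (1 / 2)) = 1 / sqrt (real n)"
          using powr_minus_divide[of "real n" "1 / 2"] powr_half_sqrt[of "real n"] by simp
        then have "(C * real n powr (- (1 / 2)))\<^sup>2 = C\<^sup>2 / real n" by (simp add: power_divide)
        then have r2: "(?r - \<rho>)\<^sup>2 \<le> C\<^sup>2 / real n"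
          using power_mono[OF r abs_ge_zero, of 2] by simp
        have r1: "\<bar>?r - \<rho>\<bar> \<le> (1 - \<rho>) / 2" using r elim(1) by linarith
        have P: "0 < 2 * (real mmax + 1)\<^sup>2" by (intro mult_pos_pos zero_less_power) auto
        have "Q C n \<omega> < real n * \<beta> n / (2 * (real mmax + 1)\<^sup>2)"
          using QQ unfolding \<kappa>_def times_divide_eq_left mult_1_left .
        then have "2 * (real mmax + 1)\<^sup>2 * Q C n \<omega> < real n * \<beta> n"
          using pos_less_divide_eq[OF P] by (metis mult.commute)
        note over = this[unfolded Q_def D_def J_def]
        have ar': "\<eta> (int i) \<omega> = \<rho> * \<eta> (int i - 1) \<omega> + \<epsilon> (int i) \<omega>" if "1 \<le> i" "i \<le> n" for i
          using ar that by auto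
        have pos: "\<Delta> n > 0" "L n > 0" using elim(5) n by (auto simp: L_def)
        have less: "?crit mstar < ?crit m" if "m \<noteq> mstar" "m \<le> mmax" for m
          by (rule true_order_minimises_penalised_SS[where y = "\<lambda>i. y n i \<omega>" and \<mu> = \<mu>
                and \<eta> = "\<lambda>i. \<eta> i \<omega>" and \<epsilon> = "\<lambda>i. \<epsilon> i \<omega>", OF s0(1,2) adm gap w0 pos y ar' \<rho> r1 r2
                h(2) less_imp_le[OF h(1)] that assms(15) nonempty[OF that(2)] over under less_imp_le[OF \<beta>n]])
        show "mhat n \<omega> = mstar"
        proof (rule ccontr)
          assume "mhat n \<omega> \<noteq> mstar"
          with mhat less[of "mhat n \<omega>"] assms(15) show False by (auto simp: is_arg_min_def)
        qed
      qed
    qed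
  qed

  have Q_int: "integrable M (Q C n)" and Q_exp: "expectation (Q C n) \<le>
      96 * \<sigma>\<^sup>2 * (real n / \<Delta> n) + sqrt (real n) * (\<sigma>\<^sup>2 * (288 + 8 * (real mstar + 2)) + 4 * C\<^sup>2 * K + 16 * J)"
    if n: "n \<ge> 1" "\<Delta> n \<ge> 1" for C n
  proof -
    have DL: "D n > 0" "L n > 0" using n by (auto simp: D_def L_def)
    note NB = noise_bound_expectation[OF indep sq mean var DL, of "s n" mstar n]
    let ?N = "\<lambda>\<omega>. noise_bound (D n) (L n) (s n) mstar n (\<lambda>i. \<epsilon> (int i) \<omega>)"
    have QI: "Q C n = (\<lambda>\<omega>. 2 * ?N \<omega> + 2 * (2 * (C\<^sup>2 / real n) * (\<Sum>i<n. (\<eta> (int i) \<omega>)\<^sup>2) + 8 * J))"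
      by (simp add: Q_def fun_eq_iff)
    show "integrable M (Q C n)" unfolding QI using NB(1) \<eta>2(1) by simp
    have sqrt: "1 \<le> sqrt (real n)" using n by simp
    have "expectation (Q C n) = 2 * expectation ?N
        + 2 * (2 * (C\<^sup>2 / real n) * (\<Sum>i<n. expectation (\<lambda>\<omega>. (\<eta> (int i) \<omega>)\<^sup>2)) + 8 * J)"
      unfolding QI using NB(1) \<eta>2(1) by (simp add: prob_space)
    also have "\<dots> \<le> 2 * (\<sigma>\<^sup>2 * (48 * (real n / \<Delta> n + sqrt (real n)) + 48 * (sqrt (real n) + sqrt (real n))
        + 2 * real (mstar + 2) * (2 * sqrt (real n)))) + 2 * (2 * (C\<^sup>2 / real n) * (\<Sum>i<n. K) + 8 * J)"
    proof (intro add_mono mult_left_mono order_refl sum_mono order_trans[OF NB(2)])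
      show "real n / real (D n) \<le> real n / \<Delta> n" using n by (intro divide_left_mono) (auto simp: D_def)
      have "real (L n) \<ge> sqrt (real n)" by (simp add: L_def of_nat_nat)
      then show "real n / real (L n) \<le> sqrt (real n)"
        using DL n sqrt mult_left_mono[of "sqrt (real n)" "real (L n)" "sqrt (real n)"]
        by (simp add: divide_simps)
      have "real (L n) < sqrt (real n) + 1" using sqrt by (simp add: L_def of_nat_nat) linarith
      then show "real (L n) \<le> 2 * sqrt (real n)" using sqrt by linarith
      show "expectation (\<lambda>\<omega>. (\<eta> (int i) \<omega>)\<^sup>2) \<le> K" for i unfolding K_def by (rule \<eta>2(2)) simp
    qed (use sqrt n in auto)
    also have "2 * (2 * (C\<^sup>2 / real n) * (\<Sum>i<n. K) + 8 * J) = 4 * C\<^sup>2 * K + 16 * J" using n by simp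
    also have "4 * C\<^sup>2 * K + 16 * J \<le> sqrt (real n) * (4 * C\<^sup>2 * K + 16 * J)"
      using mult_right_mono[OF sqrt, of "4 * C\<^sup>2 * K + 16 * J"] by (simp add: K_def J_def sum_nonneg)
    also have "2 * (\<sigma>\<^sup>2 * (48 * (real n / \<Delta> n + sqrt (real n)) + 48 * (sqrt (real n) + sqrt (real n))
        + 2 * real (mstar + 2) * (2 * sqrt (real n)))) + sqrt (real n) * (4 * C\<^sup>2 * K + 16 * J)
      = 96 * \<sigma>\<^sup>2 * (real n / \<Delta> n) + sqrt (real n) * (\<sigma>\<^sup>2 * (288 + 8 * (real mstar + 2)) + 4 * C\<^sup>2 * K + 16 * J)"
      by (simp add: algebra_simps)
    finally show "expectation (Q C n) \<le> 96 * \<sigma>\<^sup>2 * (real n / \<Delta> n)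
        + sqrt (real n) * (\<sigma>\<^sup>2 * (288 + 8 * (real mstar + 2)) + 4 * C\<^sup>2 * K + 16 * J)" by simp
  qed

  \<comment> \<open>both terms of the expectation of \<open>Q\<close> are \<open>o(n \<beta>)\<close>: this is where the two divergence hypotheses on \<open>\<beta>\<close> enter\<close>
  have Q_small: "\<forall>\<^sub>F n in sequentially. measure M {\<omega>\<in>space M. Q C n \<omega> \<ge> \<kappa> * (real n * \<beta> n)} < e"
    if "e > 0" for C e
  proof -
    define A where "A = \<sigma>\<^sup>2 * (288 + 8 * (real mstar + 2)) + 4 * C\<^sup>2 * K + 16 * J"
    have "(\<lambda>n. inverse (\<Delta> n * \<beta> n)) \<longlonglongrightarrow> 0" "(\<lambda>n. inverse (real n powr (1 / 2) * \<beta> n)) \<longlonglongrightarrow> 0"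
      by (rule tendsto_inverse_0_at_top; fact)+
    then have "(\<lambda>n. 96 * \<sigma>\<^sup>2 / \<kappa> * inverse (\<Delta> n * \<beta> n) + A / \<kappa> * inverse (real n powr (1 / 2) * \<beta> n))
        \<longlonglongrightarrow> 96 * \<sigma>\<^sup>2 / \<kappa> * 0 + A / \<kappa> * 0"
      by (intro tendsto_intros)
    then have "\<forall>\<^sub>F n in sequentially. 96 * \<sigma>\<^sup>2 / \<kappa> * inverse (\<Delta> n * \<beta> n)
        + A / \<kappa> * inverse (real n powr (1 / 2) * \<beta> n) < e"
      using that by (intro order_tendstoD) auto
    with \<Delta>1 eventually_ge_at_top[of 1] show ?thesis
    proof eventually_elim
      case (elim n)
      have \<beta>n: "\<beta> n > 0" using assms(16) elim by auto
      have sn: "sqrt (real n) > 0" "real n = sqrt (real n) * sqrt (real n)" using elim by auto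
      have c: "0 < \<kappa> * (real n * \<beta> n)" using \<kappa> \<beta>n elim by simp
      have iQ: "integrable M (Q C n)" by (rule Q_int) (use elim in auto)
      have "noise_bound D L s m n e \<ge> 0" for D L s m n e
        by (simp add: noise_bound_def block_max_nonneg sum_nonneg add_nonneg_nonneg)
      then have "Q C n \<omega> \<ge> 0" for \<omega>
        unfolding Q_def J_def
        by (intro add_nonneg_nonneg mult_nonneg_nonneg sum_nonneg divide_nonneg_nonneg) auto
      then have "measure M {\<omega>\<in>space M. Q C n \<omega> \<ge> \<kappa> * (real n * \<beta> n)}
          \<le> expectation (Q C n) / (\<kappa> * (real n * \<beta> n))"
        by (intro integral_Markov_inequality_measure[OF iQ sets.empty_sets _ c]) auto
      also have "\<dots> \<le> (96 * \<sigma>\<^sup>2 * (real n / \<Delta> n) + sqrt (real n) * A) / (\<kappa> * (real n * \<beta> n))"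
        unfolding A_def using Q_exp[of n C] c elim by (intro divide_right_mono) auto
      also have "\<dots> = 96 * \<sigma>\<^sup>2 / \<kappa> * inverse (\<Delta> n * \<beta> n) + A / \<kappa> * inverse (sqrt (real n) * \<beta> n)"
      proof -
        have "96 * \<sigma>\<^sup>2 * (real n / \<Delta> n) / (\<kappa> * (real n * \<beta> n)) = 96 * \<sigma>\<^sup>2 / \<kappa> * inverse (\<Delta> n * \<beta> n)"
          using elim \<beta>n \<kappa> by (simp add: field_simps)
        moreover have "sqrt (real n) * A / (\<kappa> * ((sqrt (real n) * sqrt (real n)) * \<beta> n))
            = A / \<kappa> * inverse (sqrt (real n) * \<beta> n)"
          using sn(1) \<beta>n \<kappa> by (simp add: field_simps del: real_sqrt_mult_self)
        ultimately show ?thesis unfolding add_divide_distrib using sn(2) by simp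
      qed
      also have "\<dots> < e" using elim by (simp add: powr_half_sqrt)
      finally show ?case .
    qed
  qed

  have mis: "\<forall>\<^sub>F n in sequentially. measure M {\<omega>\<in>space M. mhat n \<omega> \<noteq> mstar} < e" if e: "e > 0" for e
  proof -
    obtain C where C: "\<forall>\<^sub>F n in sequentially.
        measure M {\<omega>\<in>space M. \<bar>\<rho>bar n \<omega> - \<rho>\<bar> > C * real n powr (- (1 / 2))} < e / 2"
      using assms(12) e unfolding bounded_in_prob_def by (meson half_gt_zero)
    have "\<forall>\<^sub>F n in sequentially. measure M {\<omega>\<in>space M. Q C n \<omega> \<ge> \<kappa> * (real n * \<beta> n)} < e / 2"
      using e by (intro Q_small) auto
    with C good[of C] \<Delta>1 eventually_ge_at_top[of 1] show ?thesis
    proof eventually_elim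
      case (elim n)
      have [measurable]: "\<rho>bar n \<in> borel_measurable M" using assms(11) elim by auto
      have [measurable]: "Q C n \<in> borel_measurable M"
        by (rule borel_measurable_integrable[OF Q_int]) (use elim in auto)
      let ?A = "{\<omega>\<in>space M. \<bar>\<rho>bar n \<omega> - \<rho>\<bar> > C * real n powr (- (1 / 2))}"
      let ?B = "{\<omega>\<in>space M. Q C n \<omega> \<ge> \<kappa> * (real n * \<beta> n)}"
      let ?N = "{\<omega>\<in>space M. \<not> (\<forall>i\<in>{1..n}. \<eta> (int i) \<omega> = \<rho> * \<eta> (int i - 1) \<omega> + \<epsilon> (int i) \<omega>)}"
      have [measurable]: "?A \<in> sets M" "?B \<in> sets M" "?N \<in> sets M" by measurable
      have "AE \<omega> in M. \<forall>i\<in>{1..n}. \<eta> (int i) \<omega> = \<rho> * \<eta> (int i - 1) \<omega> + \<epsilon> (int i) \<omega>"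
        by (intro AE_finite_allI ar1_recursion[OF assms(9)]) simp
      then have N: "measure M ?N = 0" by (subst prob_eq_0) (auto elim: AE_mp)
      have "{\<omega>\<in>space M. mhat n \<omega> \<noteq> mstar} \<subseteq> ?A \<union> (?B \<union> ?N)"
        using elim(2) by (auto simp: not_le not_less) 
      then have "measure M {\<omega>\<in>space M. mhat n \<omega> \<noteq> mstar} \<le> measure M (?A \<union> (?B \<union> ?N))"
        by (rule finite_measure_mono) simp
      also have "\<dots> \<le> measure M ?A + (measure M ?B + measure M ?N)"
        by (intro order_trans[OF measure_Un_le] add_left_mono measure_Un_le) simp_all
      also have "\<dots> < e" using elim N by simp
      finally show ?case .
    qed
  qed
  show ?thesis
    unfolding converges_in_prob_def
  proof (intro allI impI tendstoI)
    fix d e :: real assume "d > 0" "e > 0"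
    from mis[OF \<open>e > 0\<close>] eventually_ge_at_top[of 1]
    show "\<forall>\<^sub>F n in sequentially. dist (measure M {\<omega>\<in>space M. \<bar>real (mhat n \<omega>) - real mstar\<bar> > d}) 0 < e"
    proof eventually_elim
      case (elim n)
      have [measurable]: "mhat n \<in> measurable M (count_space UNIV)" using assms(20) elim by auto
      have "measure M {\<omega>\<in>space M. \<bar>real (mhat n \<omega>) - real mstar\<bar> > d}
          \<le> measure M {\<omega>\<in>space M. mhat n \<omega> \<noteq> mstar}"
        using \<open>d > 0\<close> by (intro finite_measure_mono) auto
      with elim show ?case by simp
    qed
  qed
qed

end
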